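(* Suppose $A$ is generated by $a_1,\dots,a_m$ and let $L:A\to\mathbb R$ be a linear positive semidefinite functional such that $L(1)=1$. For $a\in A$ put $$D_a=\sup_{x\in A,\,L(x^2)\ne 0}\frac{L(ax^2)}{L(x^2)},\qquad d_a=\inf_{x\in A,\,L(x^2)\ne 0}\frac{L(ax^2)}{L(x^2)}.$$ Then there exists a unique representing Radon measure $\nu_L$ for $L$ with compact support if and only if $d_{a_1},\dots,d_{a_m}>-\infty$ and $D_{a_1+\dots+a_m}<\infty$. Moreover, in this case the support of $\nu_L$ is a subset of the set $$\{\alpha\in X(A):\alpha(a_1)\ge d_{a_1},\dots,\alpha(a_m)\ge d_{a_m},\ \alpha(a_1)+\dots+\alpha(a_m)\le D_{a_1+\dots+a_m}\}.$$
   Context: $A$ is a unital commutative $\mathbb R$-algebra and $X(A)$ is the set of all (unital) $\mathbb R$-algebra homomorphisms $A\to\mathbb R$, assumed non-empty and endowed with the topology of pointwise convergence. A linear functional $L:A\to\mathbb R$ is positive semidefinite if $L(a^2)\ge 0$ for all $a\in A$. A representing measure for $L$ is a positive Radon measure $\mu$ on $X(A)$ such that $L(a)=\int\alpha(a)\,d\mu(\alpha)$ for all $a\in A$. Generated means generated as a unital $\mathbb R$-algebra. Suprema and infima are taken in $[-\infty,\infty]$. *)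

theory Defs
  imports "HOL-Analysis.Analysis"
begin

text \<open>
  The algebra \<open>A\<close> is a type of class \<open>{real_algebra_1, comm_ring_1}\<close>. Its real characters live in the
  type \<open>'a \<Rightarrow> real\<close>, whose type class topology is the product topology, that is, the topology of
  pointwise convergence; \<open>X(A)\<close> carries the subspace topology.
\<close>

definition unital_subalgebra :: "'a::real_algebra_1 set \<Rightarrow> bool" where
  "unital_subalgebra B \<longleftrightarrow> subspace B \<and> 1 \<in> B \<and> (\<forall>x\<in>B. \<forall>y\<in>B. x * y \<in> B)"

definition generates_algebra :: "'a::real_algebra_1 set \<Rightarrow> bool" where
  "generates_algebra S \<longleftrightarrow> unital_subalgebra hull S = UNIV"

definition character_space :: "('a::{real_algebra_1,comm_ring_1} \<Rightarrow> real) set" where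
  "character_space = {\<alpha>. linear \<alpha> \<and> \<alpha> 1 = 1 \<and> (\<forall>x y. \<alpha> (x * y) = \<alpha> x * \<alpha> y)}"

definition psd_functional :: "('a::{real_algebra_1,comm_ring_1} \<Rightarrow> real) \<Rightarrow> bool" where
  "psd_functional L \<longleftrightarrow> linear L \<and> (\<forall>a. L (a\<^sup>2) \<ge> 0)"

text \<open>
  A Radon measure on \<open>X(A)\<close> is a Borel measure that is locally finite and inner regular with respect
  to compact sets. The sigma-algebra \<open>restrict_space borel S\<close> is the Borel sigma-algebra of the
  subspace \<open>S\<close>, and compact subsets of \<open>X(A)\<close> belong to it since the product topology is Hausdorff.
\<close>

definition radon_on_characters :: "('a::{real_algebra_1,comm_ring_1} \<Rightarrow> real) measure \<Rightarrow> bool" where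
  "radon_on_characters \<mu> \<longleftrightarrow>
     sets \<mu> = sets (restrict_space borel character_space) \<and>
     (\<forall>\<alpha>\<in>character_space. \<exists>U. open U \<and> \<alpha> \<in> U \<and> emeasure \<mu> (U \<inter> character_space) < \<infinity>) \<and>
     (\<forall>B\<in>sets \<mu>. emeasure \<mu> B = (SUP K\<in>{K. compact K \<and> K \<subseteq> B}. emeasure \<mu> K))"

definition representing_measure ::
  "('a::{real_algebra_1,comm_ring_1} \<Rightarrow> real) \<Rightarrow> ('a \<Rightarrow> real) measure \<Rightarrow> bool" where
  "representing_measure L \<mu> \<longleftrightarrow> radon_on_characters \<mu> \<and>
     (\<forall>a. integrable \<mu> (\<lambda>\<alpha>. \<alpha> a) \<and> L a = (\<integral>\<alpha>. \<alpha> a \<partial>\<mu>))"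

definition measure_support :: "'b::topological_space measure \<Rightarrow> 'b set" where
  "measure_support \<mu> =
     {x \<in> space \<mu>. \<forall>U. open U \<longrightarrow> x \<in> U \<longrightarrow> emeasure \<mu> (U \<inter> space \<mu>) > 0}"

text \<open>The quantities \<open>D\<^sub>a\<close> and \<open>d\<^sub>a\<close>, with values in \<open>[-\<infinity>, \<infinity>]\<close>.\<close>

definition sup_ratio :: "('a::{real_algebra_1,comm_ring_1} \<Rightarrow> real) \<Rightarrow> 'a \<Rightarrow> ereal" where
  "sup_ratio L a = (SUP x\<in>{x. L (x\<^sup>2) \<noteq> 0}. ereal (L (a * x\<^sup>2) / L (x\<^sup>2)))"

definition inf_ratio :: "('a::{real_algebra_1,comm_ring_1} \<Rightarrow> real) \<Rightarrow> 'a \<Rightarrow> ereal" where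
  "inf_ratio L a = (INF x\<in>{x. L (x\<^sup>2) \<noteq> 0}. ereal (L (a * x\<^sup>2) / L (x\<^sup>2)))"

end

theory Submission
  imports Defs "HOL-Probability.Probability"
begin

text \<open>
  Call \<open>b\<close> positive for \<open>L\<close> if \<open>L (b * x\<^sup>2) \<ge> 0\<close> for all \<open>x\<close>, that is, if multiplication by \<open>b\<close> is a
  positive operator for the inner product \<open>L (x * y)\<close>. The two conditions on the extremal ratios
  say that \<open>a\<^sub>i - c\<^sub>i\<close> and \<open>D - (a\<^sub>1 + \<dots> + a\<^sub>m)\<close> are positive for suitable constants (\<open>le_inf_ratio_iff\<close>,
  \<open>sup_ratio_le_iff\<close>). Subtracting the lower bounds of the other generators from \<open>D\<close> bounds each
  \<open>a\<^sub>i\<close> from above as well, so an affine change of generators gives \<open>t\<^sub>i\<close> with both \<open>t\<^sub>i\<close> and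
  \<open>1 - t\<^sub>i\<close> positive (\<open>bounded_generators\<close>).

  Existence is then a Hausdorff moment problem in several variables. Products of the \<open>t\<^sub>i\<close> and
  \<open>1 - t\<^sub>i\<close> are again positive by an argument of Riesz (\<open>L_pos_mult\<close>). Hence the products of Bernstein
  polynomials in the \<open>t\<^sub>i\<close> are a partition of unity on which \<open>L\<close> is nonnegative, and \<open>L\<close> turns them
  into a probability measure on a grid in the unit cube. The Bernstein variance \<open>t * (1 - t) / n\<close>
  tends to \<open>0\<close>, so integrating a polynomial against these measures recovers \<open>L\<close> in the limit
  (\<open>grid_sum_tendsto\<close>). To extract a limit measure, the grid measures are lifted to the line
  along Schoenberg's continuous curve, whose image contains the cube; on the line Helly's selection
  theorem applies (\<open>limit_measure\<close>). If a polynomial \<open>g\<close> vanishes on the generators, then the integral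
  of \<open>g\<^sup>2\<close> is \<open>L 0 = 0\<close>; so almost every point of the curve satisfies all relations between the
  generators and defines a character. The image measure on the characters represents \<open>L\<close>, and it is
  Radon because finite Borel measures on the line are inner regular.

  Conversely, evaluations are bounded on a compact support, which bounds the ratios. By the
  Stone--Weierstrass theorem every continuous function of the coordinates \<open>\<alpha> (a\<^sub>i)\<close> is, on a compact
  set of characters, a uniform limit of evaluations \<open>\<alpha> x\<close>. Therefore two compactly supported
  representing measures agree on compact sets, and by inner regularity everywhere
  (\<open>compact_representation_unique\<close>). The same approximation shows that a positive element is
  nonnegative on the support (\<open>nonneg_on_support_if_L_pos\<close>); applied to \<open>a\<^sub>i - c\<close> and \<open>D - (a\<^sub>1 + \<dots> + a\<^sub>m)\<close>
  this locates the support.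
\<close>

section \<open>Elements that act as positive operators\<close>

lemma nonneg_quadratic_discriminant:
  fixes A B C :: real
  assumes nonneg: "\<And>r. 0 \<le> A + 2 * r * B + r\<^sup>2 * C" and "0 \<le> C"
  shows "B\<^sup>2 \<le> A * C"
proof (cases "C = 0")
  case True
  have "B = 0"
  proof (rule ccontr)
    assume "B \<noteq> 0"
    then show False
      using nonneg[of "- (A + 1) / (2 * B)"] True by (simp add: field_simps)
  qed
  then show ?thesis using True by simp
next
  case False
  with \<open>0 \<le> C\<close> have "0 < C" by simp
  have "0 \<le> C * (A + 2 * (- B / C) * B + (- B / C)\<^sup>2 * C)"
    by (rule mult_nonneg_nonneg[OF \<open>0 \<le> C\<close> nonneg])
  also have "\<dots> = A * C - B\<^sup>2"
    using \<open>0 < C\<close> by (simp add: field_simps power2_eq_square)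
  finally show ?thesis by simp
qed

text \<open>
  For \<open>t\<close> in \<open>[0, 1]\<close> the iterates decrease to \<open>0\<close>, and each step splits off a square.
\<close>

primrec riesz_iterate :: "'a::comm_ring_1 \<Rightarrow> nat \<Rightarrow> 'a" where
  "riesz_iterate t 0 = t"
| "riesz_iterate t (Suc n) = riesz_iterate t n - (riesz_iterate t n)\<^sup>2"

lemma riesz_iterate_telescope:
  "t = (\<Sum>k<n. (riesz_iterate t k)\<^sup>2) + riesz_iterate t n"
  by (induction n) (auto simp: algebra_simps)

locale psd_state =
  fixes L :: "'a::{real_algebra_1,comm_ring_1} \<Rightarrow> real"
  assumes psd: "psd_functional L"
    and unit: "L 1 = 1"
begin

lemma linear_L: "linear L"
  using psd by (simp add: psd_functional_def)

lemma L_square_nonneg: "0 \<le> L (x\<^sup>2)"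
  using psd by (simp add: psd_functional_def)

lemma L_add: "L (x + y) = L x + L y"
  by (rule linear_add[OF linear_L])

lemma L_diff: "L (x - y) = L x - L y"
  by (rule linear_diff[OF linear_L])

lemma L_zero: "L 0 = 0"
  by (rule linear_0[OF linear_L])

lemma L_sum: "L (\<Sum>i\<in>I. f i) = (\<Sum>i\<in>I. L (f i))"
  by (rule linear_sum[OF linear_L])

lemma L_scale: "L (of_real r * x) = r * L x"
  using linear_scale[OF linear_L, of r x] by (simp add: scaleR_conv_of_real)

lemma L_scale_numeral: "L (numeral k * x) = numeral k * L x"
  using L_scale[of "numeral k" x] by simp

lemma L_cauchy_schwarz: "(L (x * y))\<^sup>2 \<le> L (x\<^sup>2) * L (y\<^sup>2)"
proof (rule nonneg_quadratic_discriminant)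
  fix r :: real
  have "(x + of_real r * y)\<^sup>2 = x\<^sup>2 + of_real (2 * r) * (x * y) + of_real (r\<^sup>2) * y\<^sup>2"
    by (simp add: power2_eq_square algebra_simps)
  then show "0 \<le> L (x\<^sup>2) + 2 * r * L (x * y) + r\<^sup>2 * L (y\<^sup>2)"
    using L_square_nonneg[of "x + of_real r * y"] by (simp only: L_add L_scale)
qed (rule L_square_nonneg)

text \<open>
  \<open>L_pos b\<close> says that multiplication by \<open>b\<close> is a positive operator for the inner product
  \<open>L (x * y)\<close>, although no Hilbert space is ever formed.
\<close>

definition L_pos :: "'a \<Rightarrow> bool" where
  "L_pos b \<longleftrightarrow> (\<forall>x. 0 \<le> L (b * x\<^sup>2))"

lemma L_posD: "L_pos b \<Longrightarrow> 0 \<le> L (b * x\<^sup>2)"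
  by (simp add: L_pos_def)

lemma L_nonneg: "L_pos b \<Longrightarrow> 0 \<le> L b"
  using L_posD[of b 1] by simp

lemma L_pos_add: "L_pos b \<Longrightarrow> L_pos c \<Longrightarrow> L_pos (b + c)"
  by (simp add: L_pos_def distrib_right L_add)

lemma L_pos_scale: "L_pos b \<Longrightarrow> 0 \<le> r \<Longrightarrow> L_pos (of_real r * b)"
  by (simp add: L_pos_def mult.assoc L_scale)

text \<open>
  A square factor can be absorbed into \<open>x\<^sup>2\<close>; for a positive factor that is not a square see
  \<open>L_pos_mult\<close>.
\<close>

lemma L_pos_mult_square: "L_pos b \<Longrightarrow> L_pos (b * y\<^sup>2)"
  by (simp add: L_pos_def mult.assoc flip: power_mult_distrib)

lemma L_pos_square: "L_pos (y\<^sup>2)"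
  by (simp add: L_pos_def L_square_nonneg flip: power_mult_distrib)

lemma L_pos_one: "L_pos 1"
  using L_pos_square[of 1] by simp

lemma L_pos_of_real: "0 \<le> r \<Longrightarrow> L_pos (of_real r)"
  using L_pos_scale[OF L_pos_one] by simp

lemma L_pos_sum: "(\<And>i. i \<in> I \<Longrightarrow> L_pos (f i)) \<Longrightarrow> L_pos (\<Sum>i\<in>I. f i)"
  by (auto simp: L_pos_def sum_distrib_right L_sum intro: sum_nonneg)

lemma L_pos_mult_complement:
  assumes "L_pos t" "L_pos (1 - t)"
  shows "L_pos (t * (1 - t))"
proof -
  have "t * (1 - t) = t * (1 - t)\<^sup>2 + (1 - t) * t\<^sup>2"
    by (simp add: power2_eq_square algebra_simps)
  then show ?thesis
    using assms by (simp add: L_pos_add L_pos_mult_square)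
qed

lemma riesz_iterate_bounds:
  assumes "L_pos t" "L_pos (1 - t)"
  shows "L_pos (riesz_iterate t n)" "L_pos (1 - riesz_iterate t n)"
proof (induction n)
  case (Suc n)
  let ?s = "riesz_iterate t n"
  case 1
  have "?s - ?s\<^sup>2 = ?s * (1 - ?s)"
    by (simp add: power2_eq_square algebra_simps)
  then show ?case using L_pos_mult_complement Suc by simp
  case 2
  have "1 - (?s - ?s\<^sup>2) = (1 - ?s) + ?s\<^sup>2" by simp
  then show ?case using L_pos_add[OF Suc(2) L_pos_square[of ?s]] by (simp add: algebra_simps)
qed (use assms in auto)

text \<open>
  This is Riesz' argument that the product of two commuting positive operators is positive. By the
  telescoping identity \<open>t\<close> is a sum of squares \<open>t\<^sub>k\<^sup>2\<close> plus the remainder \<open>t\<^sub>n\<close>. Multiplying \<open>b\<close> by a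
  square keeps it positive, so \<open>L (t * b * x\<^sup>2)\<close> is at least \<open>L (t\<^sub>n * b * x\<^sup>2)\<close>. The latter tends to
  \<open>0\<close> by the Cauchy--Schwarz inequality, since the partial sums of \<open>L (t\<^sub>k\<^sup>2 * x\<^sup>2)\<close> are bounded by
  \<open>L (t * x\<^sup>2)\<close>.
\<close>

lemma L_pos_mult:
  assumes t: "L_pos t" "L_pos (1 - t)" and b: "L_pos b"
  shows "L_pos (t * b)"
  unfolding L_pos_def
proof
  fix x
  let ?s = "riesz_iterate t"
  define e where "e n = L ((?s n * x)\<^sup>2)" for n
  have t_split: "L (t * y) = (\<Sum>k<n. L ((?s k)\<^sup>2 * y)) + L (?s n * y)" for y n
    by (subst riesz_iterate_telescope[of t n]) (simp add: distrib_right L_add L_sum sum_distrib_right)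
  have "summable e"
  proof (rule bounded_imp_summable)
    show "0 \<le> e n" for n by (simp add: e_def L_square_nonneg)
    show "(\<Sum>k\<le>n. e k) \<le> L (t * x\<^sup>2)" for n
      using t_split[of "x\<^sup>2" "Suc n"] L_posD[OF riesz_iterate_bounds(1)[OF t], of "Suc n" x]
      by (simp add: e_def power_mult_distrib lessThan_Suc_atMost del: riesz_iterate.simps)
  qed
  then have "e \<longlonglongrightarrow> 0" by (rule summable_LIMSEQ_zero)
  then have "(\<lambda>n. - sqrt (e n * L ((b * x)\<^sup>2))) \<longlonglongrightarrow> - sqrt (0 * L ((b * x)\<^sup>2))"
    by (intro tendsto_intros)
  moreover have "- sqrt (e n * L ((b * x)\<^sup>2)) \<le> L (t * b * x\<^sup>2)" for n
  proof -
    have "\<bar>L (?s n * x * (b * x))\<bar> \<le> sqrt (e n * L ((b * x)\<^sup>2))"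
      unfolding e_def by (metis L_cauchy_schwarz power2_abs real_le_rsqrt)
    moreover have "?s n * x * (b * x) = ?s n * (b * x\<^sup>2)"
      by (simp add: power2_eq_square algebra_simps)
    moreover have "0 \<le> L ((?s k)\<^sup>2 * (b * x\<^sup>2))" for k
      using L_posD[OF b, of "?s k * x"] by (simp add: power_mult_distrib ac_simps)
    then have "L (?s n * (b * x\<^sup>2)) \<le> L (t * (b * x\<^sup>2))"
      unfolding t_split[of "b * x\<^sup>2" n] by (simp add: sum_nonneg)
    ultimately show ?thesis by (simp add: mult.assoc)
  qed
  ultimately have "- sqrt (0 * L ((b * x)\<^sup>2)) \<le> L (t * b * x\<^sup>2)"
    by (intro LIMSEQ_le_const2) auto
  then show "0 \<le> L (t * b * x\<^sup>2)" by simp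
qed

lemma L_pos_power_mult:
  assumes t: "L_pos t" "L_pos (1 - t)" and b: "L_pos b"
  shows "L_pos (t ^ k * b)"
  by (induction k) (auto simp: b mult.assoc intro!: L_pos_mult t)

text \<open>
  The operators of bounded norm, with the norm bound \<open>sqrt C\<close> expressed by positivity alone.
\<close>

definition L_bounded :: "'a \<Rightarrow> bool" where
  "L_bounded x \<longleftrightarrow> (\<exists>C>0. L_pos (of_real C - x\<^sup>2))"

lemma L_bounded_unit_interval:
  assumes "L_pos t" "L_pos (1 - t)"
  shows "L_bounded t"
proof -
  have "of_real 1 - t\<^sup>2 = (1 - t) + t * (1 - t)"
    by (simp add: power2_eq_square algebra_simps)
  then have "L_pos (of_real 1 - t\<^sup>2)"
    using L_pos_add L_pos_mult_complement assms by metis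
  then show ?thesis unfolding L_bounded_def by (meson zero_less_one)
qed

lemma L_bounded_one: "L_bounded 1"
  unfolding L_bounded_def by (rule exI[of _ 1]) (use L_pos_of_real[of 0] in simp)

lemma L_bounded_add:
  assumes "L_bounded x" "L_bounded y"
  shows "L_bounded (x + y)"
proof -
  obtain C D where CD: "C > 0" "L_pos (of_real C - x\<^sup>2)" "D > 0" "L_pos (of_real D - y\<^sup>2)"
    using assms by (auto simp: L_bounded_def)
  have "of_real (2 * C + 2 * D) - (x + y)\<^sup>2
      = of_real 2 * (of_real C - x\<^sup>2) + of_real 2 * (of_real D - y\<^sup>2) + (x - y)\<^sup>2"
    by (simp add: power2_eq_square algebra_simps)
  then have "L_pos (of_real (2 * C + 2 * D) - (x + y)\<^sup>2)"
    using CD by (auto intro!: L_pos_add L_pos_scale L_pos_square simp del: of_real_numeral)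
  then show ?thesis
    unfolding L_bounded_def using CD by (intro exI[of _ "2 * C + 2 * D"]) auto
qed

text \<open>
  Dividing by \<open>C\<close> makes \<open>C - x\<^sup>2\<close> an element between \<open>0\<close> and \<open>1\<close>, since its complement is then the
  square \<open>x\<^sup>2 / C\<close>.
\<close>

lemma L_pos_bound_mult:
  assumes "C > 0" "L_pos (of_real C - x\<^sup>2)" "L_pos b"
  shows "L_pos ((of_real C - x\<^sup>2) * b)"
proof -
  let ?t = "of_real (1 / C) * (of_real C - x\<^sup>2)"
  have 1: "of_real (1 / C) * of_real C = (1::'a)"
    using \<open>C > 0\<close> by (simp only: flip: of_real_mult) simp
  then have "1 - ?t = of_real (1 / C) * x\<^sup>2"
    by (simp only: right_diff_distrib) (simp del: of_real_divide)
  then have "L_pos (?t * b)"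
    using assms by (intro L_pos_mult[OF _ _ \<open>L_pos b\<close>]) (auto intro!: L_pos_scale L_pos_square simp del: of_real_divide)
  then have "L_pos (of_real C * (?t * b))"
    using \<open>C > 0\<close> by (intro L_pos_scale) auto
  moreover have "of_real C * (?t * b) = (of_real (1 / C) * of_real C) * ((of_real C - x\<^sup>2) * b)"
    by (simp only: ac_simps)
  ultimately show ?thesis using 1 by simp
qed

lemma L_bounded_mult:
  assumes "L_bounded x" "L_bounded y"
  shows "L_bounded (x * y)"
proof -
  obtain C D where CD: "C > 0" "L_pos (of_real C - x\<^sup>2)" "D > 0" "L_pos (of_real D - y\<^sup>2)"
    using assms by (auto simp: L_bounded_def)
  have "of_real (C * D) - (x * y)\<^sup>2 = of_real C * (of_real D - y\<^sup>2) + (of_real C - x\<^sup>2) * y\<^sup>2"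
    by (simp add: power2_eq_square algebra_simps)
  then have "L_pos (of_real (C * D) - (x * y)\<^sup>2)"
    using CD by (simp only:) (auto intro!: L_pos_add L_pos_scale L_pos_mult_square)
  then show ?thesis
    unfolding L_bounded_def using CD by (intro exI[of _ "C * D"]) auto
qed

lemma L_bounded_scale:
  assumes "L_bounded x"
  shows "L_bounded (of_real r * x)"
proof -
  obtain C where C: "C > 0" "L_pos (of_real C - x\<^sup>2)"
    using assms by (auto simp: L_bounded_def)
  have "of_real (r\<^sup>2 * C + 1) - (of_real r * x)\<^sup>2 = of_real (r\<^sup>2) * (of_real C - x\<^sup>2) + of_real 1"
    by (simp add: power2_eq_square algebra_simps)
  then have "L_pos (of_real (r\<^sup>2 * C + 1) - (of_real r * x)\<^sup>2)"
    using C by (simp only:) (intro L_pos_add L_pos_scale L_pos_of_real; simp)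
  moreover have "r\<^sup>2 * C + 1 > 0" using C by (simp add: add_nonneg_pos)
  ultimately show ?thesis unfolding L_bounded_def by blast
qed

end

section \<open>Bernstein weights in a commutative ring\<close>

definition bernstein_weight :: "nat \<Rightarrow> nat \<Rightarrow> 'a \<Rightarrow> 'a::comm_ring_1" where
  "bernstein_weight n k t = of_nat (n choose k) * t ^ k * (1 - t) ^ (n - k)"

lemma sum_bernstein_weight: "(\<Sum>k\<le>n. bernstein_weight n k t) = 1"
  using binomial_ring[of t "1 - t" n] by (simp add: bernstein_weight_def)

text \<open>
  The absorption identity of binomial coefficients. It lowers the degree by one, so each moment
  of the weights reduces to a lower one.
\<close>

lemma index_times_bernstein_weight:
  "of_nat (Suc k) * bernstein_weight (Suc n) (Suc k) t = of_nat (Suc n) * t * bernstein_weight n k t"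
proof -
  have "of_nat (Suc k) * of_nat (Suc n choose Suc k) = (of_nat (Suc n) * of_nat (n choose k) :: 'a)"
    using arg_cong[OF Suc_times_binomial, of of_nat] by (simp only: of_nat_mult)
  then have "(of_nat (Suc k) * of_nat (Suc n choose Suc k)) * (t * t ^ k * (1 - t) ^ (n - k))
      = (of_nat (Suc n) * of_nat (n choose k)) * (t * t ^ k * (1 - t) ^ (n - k))"
    by (simp only:)
  then show ?thesis
    unfolding bernstein_weight_def power_Suc diff_Suc_Suc by (simp only: ac_simps)
qed

lemma sum_index_bernstein_weight:
  "(\<Sum>k\<le>Suc n. of_nat k * f k * bernstein_weight (Suc n) k t)
    = of_nat (Suc n) * t * (\<Sum>k\<le>n. f (Suc k) * bernstein_weight n k t)"
proof -
  have "(\<Sum>k\<le>Suc n. of_nat k * f k * bernstein_weight (Suc n) k t)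
      = (\<Sum>k\<le>n. of_nat (Suc k) * f (Suc k) * bernstein_weight (Suc n) (Suc k) t)"
    by (subst sum.atMost_Suc_shift) simp
  also have "\<dots> = (\<Sum>k\<le>n. of_nat (Suc n) * t * (f (Suc k) * bernstein_weight n k t))"
  proof (rule sum.cong)
    fix k
    have "of_nat (Suc k) * f (Suc k) * bernstein_weight (Suc n) (Suc k) t
        = f (Suc k) * (of_nat (Suc k) * bernstein_weight (Suc n) (Suc k) t)"
      by (simp only: ac_simps)
    also have "\<dots> = of_nat (Suc n) * t * (f (Suc k) * bernstein_weight n k t)"
      by (simp only: index_times_bernstein_weight ac_simps)
    finally show "of_nat (Suc k) * f (Suc k) * bernstein_weight (Suc n) (Suc k) t
        = of_nat (Suc n) * t * (f (Suc k) * bernstein_weight n k t)" .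
  qed simp
  finally show ?thesis by (simp only: sum_distrib_left)
qed

lemma bernstein_weight_mean: "(\<Sum>k\<le>n. of_nat k * bernstein_weight n k t) = of_nat n * t"
proof (cases n)
  case (Suc m)
  then show ?thesis
    using sum_index_bernstein_weight[of "\<lambda>_. 1" m t] by (simp add: sum_bernstein_weight del: sum.atMost_Suc)
qed simp

lemma bernstein_weight_second_moment:
  "(\<Sum>k\<le>n. (of_nat k)\<^sup>2 * bernstein_weight n k t) = of_nat n * t * (1 - t) + (of_nat n * t)\<^sup>2"
proof (cases n)
  case (Suc m)
  have "(\<Sum>k\<le>Suc m. (of_nat k)\<^sup>2 * bernstein_weight (Suc m) k t)
      = of_nat (Suc m) * t * (\<Sum>k\<le>m. of_nat k * bernstein_weight m k t + bernstein_weight m k t)"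
    using sum_index_bernstein_weight[of of_nat m t]
    by (simp add: power2_eq_square distrib_right add.commute del: sum.atMost_Suc)
  also have "\<dots> = of_nat (Suc m) * t * (of_nat m * t + 1)"
    by (simp add: sum.distrib bernstein_weight_mean sum_bernstein_weight)
  finally show ?thesis
    by (simp add: Suc power2_eq_square algebra_simps del: sum.atMost_Suc)
qed simp

text \<open>
  The variance of a binomial distribution with success probability \<open>t\<close>, as an identity in the ring.
\<close>

lemma bernstein_weight_variance:
  "(\<Sum>k\<le>n. (of_nat n * t - of_nat k)\<^sup>2 * bernstein_weight n k t) = of_nat n * (t * (1 - t))"
proof -
  have "(of_nat n * t - of_nat k)\<^sup>2 * bernstein_weight n k t
      = (of_nat n * t)\<^sup>2 * bernstein_weight n k t - 2 * (of_nat n * t) * (of_nat k * bernstein_weight n k t)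
        + (of_nat k)\<^sup>2 * bernstein_weight n k t" for k
    by (simp add: power2_eq_square algebra_simps)
  then have "(\<Sum>k\<le>n. (of_nat n * t - of_nat k)\<^sup>2 * bernstein_weight n k t)
      = (of_nat n * t)\<^sup>2 * (\<Sum>k\<le>n. bernstein_weight n k t)
        - 2 * (of_nat n * t) * (\<Sum>k\<le>n. of_nat k * bernstein_weight n k t)
        + (\<Sum>k\<le>n. (of_nat k)\<^sup>2 * bernstein_weight n k t)"
    by (simp only: sum.distrib sum_subtractf sum_distrib_left)
  then show ?thesis
    unfolding sum_bernstein_weight bernstein_weight_mean bernstein_weight_second_moment
    by (simp add: power2_eq_square algebra_simps)
qed

section \<open>Discretisation of a bounded functional\<close>

text \<open>
  The pairs of an element of the algebra generated by the \<open>t i\<close> and a polynomial function that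
  represents it. The representing function is unique only up to relations between the generators,
  which is why this is a relation rather than a function.
\<close>

inductive polynomial_lift ::
  "(nat \<Rightarrow> 'a::{real_algebra_1,comm_ring_1}) \<Rightarrow> nat set \<Rightarrow> 'a \<Rightarrow> ((nat \<Rightarrow> real) \<Rightarrow> real) \<Rightarrow> bool"
  for t I where
  lift_one: "polynomial_lift t I 1 (\<lambda>_. 1)"
| lift_generator: "i \<in> I \<Longrightarrow> polynomial_lift t I (t i) (\<lambda>u. u i)"
| lift_add: "polynomial_lift t I x f \<Longrightarrow> polynomial_lift t I y g \<Longrightarrow>
    polynomial_lift t I (x + y) (\<lambda>u. f u + g u)"
| lift_mult: "polynomial_lift t I x f \<Longrightarrow> polynomial_lift t I y g \<Longrightarrow>
    polynomial_lift t I (x * y) (\<lambda>u. f u * g u)"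
| lift_scale: "polynomial_lift t I x f \<Longrightarrow> polynomial_lift t I (of_real r * x) (\<lambda>u. r * f u)"

lemma polynomial_lift_exists:
  assumes "generates_algebra (t ` I)"
  shows "\<exists>f. polynomial_lift t I x f"
proof -
  let ?B = "{x. \<exists>f. polynomial_lift t I x f}"
  have "unital_subalgebra ?B"
    unfolding unital_subalgebra_def subspace_def
    using lift_scale[OF lift_one, of t I 0]
    by (auto simp: scaleR_conv_of_real intro: lift_one lift_add lift_mult lift_scale)
  moreover have "t ` I \<subseteq> ?B" by (auto intro: lift_generator)
  ultimately have "unital_subalgebra hull (t ` I) \<subseteq> ?B" by (simp add: hull_minimal)
  then show ?thesis using assms by (auto simp: generates_algebra_def)
qed

lemma continuous_on_polynomial_lift: "polynomial_lift t I x f \<Longrightarrow> continuous_on UNIV f"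
  by (induction rule: polynomial_lift.induct)
    (intro continuous_on_const continuous_on_product_coordinates continuous_on_add
      continuous_on_mult; assumption)+

text \<open>
  The bound is over the cube \<open>[0, 2]\<close> rather than \<open>[0, 1]\<close> because the space-filling curve used
  below stays only in the larger cube.
\<close>

lemma polynomial_lift_bounded:
  assumes "polynomial_lift t I x f"
  shows "\<exists>C. \<forall>u. (\<forall>i. 0 \<le> u i \<and> u i \<le> 2) \<longrightarrow> \<bar>f u\<bar> \<le> C"
  using assms
proof (induction rule: polynomial_lift.induct)
  case (lift_one)
  show ?case by (rule exI[of _ 1]) simp
next
  case (lift_generator i)
  have "\<bar>u i\<bar> \<le> 2" if "\<forall>i. 0 \<le> u i \<and> u i \<le> 2" for u :: "nat \<Rightarrow> real"
    using that[rule_format, of i] by simp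
  then show ?case by blast
next
  case (lift_add x f y g)
  then obtain C D where "\<forall>u. (\<forall>i. 0 \<le> u i \<and> u i \<le> 2) \<longrightarrow> \<bar>f u\<bar> \<le> C"
    "\<forall>u. (\<forall>i. 0 \<le> u i \<and> u i \<le> 2) \<longrightarrow> \<bar>g u\<bar> \<le> D" by blast
  then have "\<bar>f u + g u\<bar> \<le> C + D" if "\<forall>i. 0 \<le> u i \<and> u i \<le> 2" for u
    using that abs_triangle_ineq[of "f u" "g u"] by (meson add_mono order_trans)
  then show ?case by blast
next
  case (lift_mult x f y g)
  then obtain C D where "\<forall>u. (\<forall>i. 0 \<le> u i \<and> u i \<le> 2) \<longrightarrow> \<bar>f u\<bar> \<le> C"
    "\<forall>u. (\<forall>i. 0 \<le> u i \<and> u i \<le> 2) \<longrightarrow> \<bar>g u\<bar> \<le> D" by blast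
  then have "\<bar>f u * g u\<bar> \<le> C * D" if "\<forall>i. 0 \<le> u i \<and> u i \<le> 2" for u
    unfolding abs_mult using that by (intro mult_mono') auto
  then show ?case by blast
next
  case (lift_scale x f r)
  then obtain C where "\<forall>u. (\<forall>i. 0 \<le> u i \<and> u i \<le> 2) \<longrightarrow> \<bar>f u\<bar> \<le> C" by blast
  then show ?case
    by (intro exI[of _ "\<bar>r\<bar> * C"]) (auto simp: abs_mult intro!: mult_left_mono)
qed

locale bounded_psd_state = psd_state L for L :: "'a::{real_algebra_1,comm_ring_1} \<Rightarrow> real" +
  fixes t :: "nat \<Rightarrow> 'a" and I :: "nat set"
  assumes finite_I: "finite I"
    and generates: "generates_algebra (t ` I)"
    and t_pos: "i \<in> I \<Longrightarrow> L_pos (t i)"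
    and t_le_1: "i \<in> I \<Longrightarrow> L_pos (1 - t i)"
begin

text \<open>
  The index set of the products of Bernstein polynomials of degree \<open>n\<close> in each generator; such a
  product concentrates near its \<open>node\<close>. Coordinates outside \<open>I\<close> are set to \<open>0\<close> to keep the node in
  the cube.
\<close>

definition grid :: "nat \<Rightarrow> (nat \<Rightarrow> nat) set" where
  "grid n = (\<Pi>\<^sub>E i\<in>I. {..n})"

definition weight :: "nat \<Rightarrow> (nat \<Rightarrow> nat) \<Rightarrow> 'a" where
  "weight n k = (\<Prod>i\<in>I. bernstein_weight n (k i) (t i))"

definition node :: "nat \<Rightarrow> (nat \<Rightarrow> nat) \<Rightarrow> nat \<Rightarrow> real" where
  "node n k i = (if i \<in> I then real (k i) / real n else 0)"

lemma finite_grid: "finite (grid n)"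
  unfolding grid_def using finite_I by (intro finite_PiE) auto

lemma node_bounds: "k \<in> grid n \<Longrightarrow> 0 \<le> node n k i \<and> node n k i \<le> 1"
  by (auto simp: node_def grid_def PiE_iff divide_simps)

lemma sum_weight: "(\<Sum>k\<in>grid n. weight n k) = 1"
  unfolding grid_def weight_def using finite_I
  by (subst prod_sum_PiE[symmetric]) (simp_all add: sum_bernstein_weight)

lemma L_pos_bernstein_weight_mult:
  assumes "i \<in> I" "L_pos b"
  shows "L_pos (bernstein_weight n k (t i) * b)"
proof -
  have "L_pos (t i ^ k * ((1 - t i) ^ (n - k) * b))"
    using t_pos[OF \<open>i \<in> I\<close>] t_le_1[OF \<open>i \<in> I\<close>] by (intro L_pos_power_mult assms) simp_all
  then have "L_pos (of_real (real (n choose k)) * (t i ^ k * ((1 - t i) ^ (n - k) * b)))"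
    by (rule L_pos_scale) simp
  then show ?thesis by (simp add: bernstein_weight_def mult.assoc)
qed

lemma L_pos_weight: "L_pos (weight n k)"
  unfolding weight_def using finite_I
  by (rule finite_subset_induct[OF _ order_refl]) (auto intro: L_pos_one L_pos_bernstein_weight_mult)

text \<open>
  The sum factors over the generators: every factor with \<open>j \<noteq> i\<close> is a full sum of Bernstein
  weights, hence \<open>1\<close>, and the factor at \<open>i\<close> is the one-variable variance.
\<close>

lemma weight_variance:
  assumes "i \<in> I" "n > 0"
  shows "(\<Sum>k\<in>grid n. (t i - of_real (node n k i))\<^sup>2 * weight n k) = of_real (1 / real n) * (t i * (1 - t i))"
proof -
  let ?g = "\<lambda>j k. (if j = i then (of_nat n * t i - of_nat k)\<^sup>2 else 1) * bernstein_weight n k (t j)"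
  have split: "(of_nat n * t i - of_nat (k i))\<^sup>2 * weight n k = (\<Prod>j\<in>I. ?g j (k j))" for k
  proof -
    have "(\<Prod>j\<in>I. ?g j (k j)) = (\<Prod>j\<in>I. if j = i then (of_nat n * t i - of_nat (k j))\<^sup>2 else 1) * weight n k"
      by (simp add: prod.distrib weight_def)
    also have "\<dots> = (of_nat n * t i - of_nat (k i))\<^sup>2 * weight n k"
      using assms finite_I by (simp add: prod.delta)
    finally show ?thesis by simp
  qed
  have "(\<Sum>k\<in>grid n. (of_nat n * t i - of_nat (k i))\<^sup>2 * weight n k) = (\<Prod>j\<in>I. \<Sum>k\<le>n. ?g j k)"
    unfolding split grid_def using finite_I by (simp add: prod_sum_PiE)
  also have "\<dots> = (\<Prod>j\<in>I. if j = i then of_nat n * (t i * (1 - t i)) else 1)"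
    by (intro prod.cong) (auto simp: bernstein_weight_variance sum_bernstein_weight)
  also have "\<dots> = of_nat n * (t i * (1 - t i))"
    using assms finite_I by simp
  finally have scaled: "(\<Sum>k\<in>grid n. (of_nat n * t i - of_nat (k i))\<^sup>2 * weight n k)
      = of_nat n * (t i * (1 - t i))" .
  have inv: "of_real (1 / real n) * of_nat n = (1::'a)"
  proof -
    have "of_real (1 / real n * real n) = (1::'a)" using assms by simp
    then show ?thesis by (simp only: of_real_mult of_real_of_nat_eq)
  qed
  have "t i - of_real (node n k i) = of_real (1 / real n) * (of_nat n * t i - of_nat (k i))" for k
  proof -
    have "of_real (node n k i) = of_real (1 / real n) * (of_nat (k i) :: 'a)"
    proof -
      have "of_real (1 / real n * real (k i)) = of_real (1 / real n) * (of_nat (k i) :: 'a)"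
        by (simp only: of_real_mult of_real_of_nat_eq)
      then show ?thesis using assms by (simp add: node_def del: of_real_divide)
    qed
    moreover have "of_real (1 / real n) * (of_nat n * t i) = t i"
      by (simp only: inv mult_1_left flip: mult.assoc)
    ultimately show ?thesis by (simp only: right_diff_distrib)
  qed
  then have "(t i - of_real (node n k i))\<^sup>2 * weight n k
      = of_real (1 / real n) * of_real (1 / real n) * ((of_nat n * t i - of_nat (k i))\<^sup>2 * weight n k)" for k
    by (simp only: power2_eq_square ac_simps)
  then have "(\<Sum>k\<in>grid n. (t i - of_real (node n k i))\<^sup>2 * weight n k)
      = of_real (1 / real n) * of_real (1 / real n) * (of_nat n * (t i * (1 - t i)))"
    by (simp only: scaled flip: sum_distrib_left)
  also have "\<dots> = of_real (1 / real n) * (of_real (1 / real n) * of_nat n) * (t i * (1 - t i))"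
    by (simp only: ac_simps)
  finally show ?thesis by (simp only: inv mult_1_right)
qed

lemma L_bounded_polynomial_lift: "polynomial_lift t I x f \<Longrightarrow> L_bounded x"
  by (induction rule: polynomial_lift.induct)
    (auto intro: L_bounded_one L_bounded_unit_interval t_pos t_le_1 L_bounded_add L_bounded_mult
      L_bounded_scale)

text \<open>
  The mean square distance between the operator \<open>x\<close> and the scalars \<open>f (node n k)\<close> that replace it
  on the pieces of the partition of unity. Unlike convergence of the integrals themselves, convergence
  of this quantity to \<open>0\<close> is inherited by products.
\<close>

definition deviation :: "'a \<Rightarrow> ((nat \<Rightarrow> real) \<Rightarrow> real) \<Rightarrow> nat \<Rightarrow> real" where
  "deviation x f n = (\<Sum>k\<in>grid n. L ((x - of_real (f (node n k)))\<^sup>2 * weight n k))"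

lemma L_weight_square_nonneg: "0 \<le> L (x\<^sup>2 * weight n k)"
  using L_posD[OF L_pos_weight] by (simp add: mult.commute)

lemma deviation_nonneg: "0 \<le> deviation x f n"
  unfolding deviation_def by (intro sum_nonneg L_weight_square_nonneg)

lemma L_weight_square_add:
  "L ((x + y)\<^sup>2 * weight n k) \<le> 2 * L (x\<^sup>2 * weight n k) + 2 * L (y\<^sup>2 * weight n k)"
proof -
  have "2 * (x\<^sup>2 * weight n k) + 2 * (y\<^sup>2 * weight n k) = (x + y)\<^sup>2 * weight n k + (x - y)\<^sup>2 * weight n k"
    by (simp add: power2_eq_square algebra_simps)
  then have "2 * L (x\<^sup>2 * weight n k) + 2 * L (y\<^sup>2 * weight n k)
      = L ((x + y)\<^sup>2 * weight n k) + L ((x - y)\<^sup>2 * weight n k)"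
    by (metis L_add L_scale_numeral)
  then show ?thesis using L_weight_square_nonneg[of "x - y" n k] by linarith
qed

lemma L_weight_square_scale:
  "L ((of_real r * x)\<^sup>2 * weight n k) = r\<^sup>2 * L (x\<^sup>2 * weight n k)"
  by (simp add: power_mult_distrib mult.assoc L_scale flip: of_real_power)

lemma L_weight_square_mult:
  assumes "C > 0" "L_pos (of_real C - x\<^sup>2)"
  shows "L ((x * y)\<^sup>2 * weight n k) \<le> C * L (y\<^sup>2 * weight n k)"
proof -
  have "of_real C * (y\<^sup>2 * weight n k) = (of_real C - x\<^sup>2) * weight n k * y\<^sup>2 + (x * y)\<^sup>2 * weight n k"
    by (simp add: power2_eq_square algebra_simps)
  then have "C * L (y\<^sup>2 * weight n k)
      = L ((of_real C - x\<^sup>2) * weight n k * y\<^sup>2) + L ((x * y)\<^sup>2 * weight n k)"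
    by (metis L_add L_scale)
  then show ?thesis using L_posD[OF L_pos_bound_mult[OF assms L_pos_weight]] by simp
qed

lemma deviation_tendsto_zero_comparison:
  assumes "\<And>n. deviation x f n \<le> g n" "g \<longlonglongrightarrow> 0"
  shows "deviation x f \<longlonglongrightarrow> 0"
  using assms(2)
  by (rule tendsto_sandwich[OF _ _ tendsto_const, rotated 2])
    (rule always_eventually, rule allI, rule deviation_nonneg assms(1))+

text \<open>
  For products, \<open>x * y - f * g = x * (y - g) + g * (x - f)\<close>, where \<open>x\<close> is a bounded operator and \<open>g\<close>
  is bounded on the cube.
\<close>

lemma deviation_tendsto_zero:
  assumes "polynomial_lift t I x f"
  shows "deviation x f \<longlonglongrightarrow> 0"
  using assms
proof (induction rule: polynomial_lift.induct)
  case lift_one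
  then show ?case by (simp add: deviation_def L_zero)
next
  case (lift_generator i)
  have "deviation (t i) (\<lambda>u. u i) n = inverse (real n) * L (t i * (1 - t i))" if "n > 0" for n
    using weight_variance[OF lift_generator that]
    by (simp add: deviation_def L_scale inverse_eq_divide del: of_real_divide flip: L_sum)
  then have "\<forall>\<^sub>F n in sequentially. inverse (real n) * L (t i * (1 - t i)) = deviation (t i) (\<lambda>u. u i) n"
    by (intro eventually_sequentiallyI[of 1]) auto
  moreover have "(\<lambda>n. inverse (real n) * L (t i * (1 - t i))) \<longlonglongrightarrow> 0"
    using tendsto_mult[OF lim_inverse_n tendsto_const] by simp
  ultimately show ?case by (rule Lim_transform_eventually[rotated])
next
  case (lift_add x f y g)
  have bound: "deviation (x + y) (\<lambda>u. f u + g u) n \<le> 2 * deviation x f n + 2 * deviation y g n" for n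
  proof -
    have "L ((x + y - of_real (f (node n k) + g (node n k)))\<^sup>2 * weight n k)
        \<le> 2 * L ((x - of_real (f (node n k)))\<^sup>2 * weight n k)
          + 2 * L ((y - of_real (g (node n k)))\<^sup>2 * weight n k)" for k
      using L_weight_square_add[of "x - of_real (f (node n k))" "y - of_real (g (node n k))" n k]
      by (simp add: algebra_simps)
    then show ?thesis
      unfolding deviation_def by (auto simp: sum_distrib_left simp flip: sum.distrib intro: sum_mono)
  qed
  have "(\<lambda>n. 2 * deviation x f n + 2 * deviation y g n) \<longlonglongrightarrow> 2 * 0 + 2 * 0"
    by (intro tendsto_intros lift_add.IH)
  then show ?case
    by (intro deviation_tendsto_zero_comparison[OF bound]) simp
next
  case (lift_mult x f y g)
  obtain C where C: "C > 0" "L_pos (of_real C - x\<^sup>2)"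
    using L_bounded_polynomial_lift[OF lift_mult.hyps(1)] by (auto simp: L_bounded_def)
  obtain D where D: "\<And>u. (\<And>i. 0 \<le> u i \<and> u i \<le> 2) \<Longrightarrow> \<bar>g u\<bar> \<le> D"
    using polynomial_lift_bounded[OF lift_mult.hyps(2)] by blast
  have bound: "deviation (x * y) (\<lambda>u. f u * g u) n \<le> 2 * C * deviation y g n + 2 * D\<^sup>2 * deviation x f n" for n
  proof -
    have "L ((x * y - of_real (f (node n k) * g (node n k)))\<^sup>2 * weight n k)
        \<le> 2 * C * L ((y - of_real (g (node n k)))\<^sup>2 * weight n k)
          + 2 * D\<^sup>2 * L ((x - of_real (f (node n k)))\<^sup>2 * weight n k)" if k: "k \<in> grid n" for k
    proof -
      let ?p = "x - of_real (f (node n k))" and ?q = "y - of_real (g (node n k))"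
      have "x * y - of_real (f (node n k) * g (node n k)) = x * ?q + of_real (g (node n k)) * ?p"
        by (simp add: algebra_simps)
      then have "L ((x * y - of_real (f (node n k) * g (node n k)))\<^sup>2 * weight n k)
          \<le> 2 * L ((x * ?q)\<^sup>2 * weight n k) + 2 * ((g (node n k))\<^sup>2 * L (?p\<^sup>2 * weight n k))"
        using L_weight_square_add[of "x * ?q" "of_real (g (node n k)) * ?p" n k]
        by (simp only: L_weight_square_scale)
      moreover have "L ((x * ?q)\<^sup>2 * weight n k) \<le> C * L (?q\<^sup>2 * weight n k)"
        by (rule L_weight_square_mult[OF C])
      moreover have "\<bar>g (node n k)\<bar> \<le> D"
        using node_bounds[OF k] by (intro D) (smt (verit))
      then have "(g (node n k))\<^sup>2 \<le> D\<^sup>2"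
        by (metis abs_ge_zero power2_abs power_mono)
      then have "(g (node n k))\<^sup>2 * L (?p\<^sup>2 * weight n k) \<le> D\<^sup>2 * L (?p\<^sup>2 * weight n k)"
        by (intro mult_right_mono L_weight_square_nonneg)
      ultimately show ?thesis by linarith
    qed
    then show ?thesis
      unfolding deviation_def by (auto simp: sum_distrib_left simp flip: sum.distrib intro!: sum_mono)
  qed
  have "(\<lambda>n. 2 * C * deviation y g n + 2 * D\<^sup>2 * deviation x f n) \<longlonglongrightarrow> 2 * C * 0 + 2 * D\<^sup>2 * 0"
    by (intro tendsto_intros lift_mult.IH)
  then show ?case
    by (intro deviation_tendsto_zero_comparison[OF bound]) simp
next
  case (lift_scale x f r)
  have "deviation (of_real r * x) (\<lambda>u. r * f u) n = r\<^sup>2 * deviation x f n" for n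
  proof -
    have "of_real r * x - of_real (r * f u) = of_real r * (x - of_real (f u))" for u
      by (simp add: algebra_simps)
    then show ?thesis
      by (simp only: deviation_def L_weight_square_scale sum_distrib_left)
  qed
  then show ?case
    using tendsto_mult_left[OF lift_scale.IH, of "r\<^sup>2"] by simp
qed

text \<open>
  With \<open>e\<close> the difference of \<open>L x\<close> and the sum, the mean of \<open>x - f (node n k)\<close> under the weights is \<open>e\<close>,
  so that its square is at most the mean square: \<open>e\<^sup>2\<close> is bounded by the deviation.
\<close>

lemma grid_sum_tendsto:
  assumes "polynomial_lift t I x f"
  shows "(\<lambda>n. \<Sum>k\<in>grid n. f (node n k) * L (weight n k)) \<longlonglongrightarrow> L x"
proof -
  have "\<bar>L x - (\<Sum>k\<in>grid n. f (node n k) * L (weight n k))\<bar>\<^sup>2 \<le> deviation x f n" for n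
  proof -
    let ?d = "\<lambda>k. x - of_real (f (node n k))" and ?S = "\<Sum>k\<in>grid n. f (node n k) * L (weight n k)"
    let ?e = "L x - ?S"
    have mean: "(\<Sum>k\<in>grid n. L (?d k * weight n k)) = ?e"
    proof -
      have "(\<Sum>k\<in>grid n. ?d k * weight n k)
          = x * (\<Sum>k\<in>grid n. weight n k) - (\<Sum>k\<in>grid n. of_real (f (node n k)) * weight n k)"
        by (simp only: left_diff_distrib sum_subtractf sum_distrib_left)
      then have "L (\<Sum>k\<in>grid n. ?d k * weight n k)
          = L x - L (\<Sum>k\<in>grid n. of_real (f (node n k)) * weight n k)"
        by (simp add: sum_weight L_diff)
      then show ?thesis by (simp only: L_sum L_scale)
    qed
    have "0 \<le> (\<Sum>k\<in>grid n. L ((?d k - of_real ?e)\<^sup>2 * weight n k))"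
      by (intro sum_nonneg L_weight_square_nonneg)
    also have "\<dots> = (\<Sum>k\<in>grid n. L ((?d k)\<^sup>2 * weight n k) - 2 * ?e * L (?d k * weight n k)
        + ?e\<^sup>2 * L (weight n k))"
    proof (rule sum.cong)
      fix k
      have "(?d k - of_real ?e)\<^sup>2 * weight n k = (?d k)\<^sup>2 * weight n k
          - of_real (2 * ?e) * (?d k * weight n k) + of_real (?e\<^sup>2) * weight n k"
        by (simp add: power2_eq_square algebra_simps)
      then show "L ((?d k - of_real ?e)\<^sup>2 * weight n k) = L ((?d k)\<^sup>2 * weight n k)
          - 2 * ?e * L (?d k * weight n k) + ?e\<^sup>2 * L (weight n k)"
        by (simp only: L_add L_diff L_scale)
    qed simp
    also have "\<dots> = deviation x f n - 2 * ?e * (\<Sum>k\<in>grid n. L (?d k * weight n k))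
        + ?e\<^sup>2 * L (\<Sum>k\<in>grid n. weight n k)"
      by (simp only: deviation_def L_sum sum.distrib sum_subtractf sum_distrib_left)
    \<comment> \<open>The weights sum to \<open>1\<close> and the mean is \<open>?e\<close>, so the cross term is \<open>- 2 * ?e\<^sup>2\<close>.\<close>
    also have "\<dots> = deviation x f n - ?e\<^sup>2"
      unfolding mean sum_weight unit by (simp add: power2_eq_square)
    finally show ?thesis by simp
  qed
  then have bound: "\<bar>(\<Sum>k\<in>grid n. f (node n k) * L (weight n k)) - L x\<bar> \<le> sqrt (deviation x f n)" for n
    by (metis abs_minus_commute real_le_rsqrt)
  have "(\<lambda>n. sqrt (deviation x f n)) \<longlonglongrightarrow> 0"
    using tendsto_real_sqrt[OF deviation_tendsto_zero[OF assms]] by simp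
  then have "(\<lambda>n. (\<Sum>k\<in>grid n. f (node n k) * L (weight n k)) - L x) \<longlonglongrightarrow> 0"
    by (rule Lim_null_comparison[rotated]) (rule always_eventually, simp add: bound)
  then show ?thesis by (rule LIM_zero_cancel)
qed

end

section \<open>A curve through the Hilbert cube\<close>

text \<open>
  A continuous function of period \<open>2\<close> that is \<open>0\<close> on \<open>[0, 1/3]\<close> and \<open>1\<close> on \<open>[2/3, 1]\<close>; it reads off
  the leading digit of a ternary expansion with digits \<open>0\<close> and \<open>2\<close>. Truncating a cosine gives the
  two plateaus, because \<open>cos\<close> is at least \<open>1/2\<close> up to \<open>pi / 3\<close>.
\<close>

definition schoenberg_profile :: "real \<Rightarrow> real" where
  "schoenberg_profile x = max 0 (min 1 (1 / 2 - cos (pi * x)))"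

lemma schoenberg_profile_bounds: "0 \<le> schoenberg_profile x" "schoenberg_profile x \<le> 1"
  by (auto simp: schoenberg_profile_def)

lemma continuous_on_schoenberg_profile: "continuous_on S schoenberg_profile"
  unfolding schoenberg_profile_def by (intro continuous_intros)

lemma schoenberg_profile_digit:
  fixes N :: int
  assumes r: "0 \<le> r" "r \<le> 1 / 3" and d: "d \<in> {0, 1}"
  shows "schoenberg_profile (2 * of_int N + 2 * d / 3 + r) = d"
proof -
  have periodic: "cos (pi * (2 * of_int N + y)) = cos (pi * y)" for y
  proof -
    have "pi * (2 * of_int N + y) = 2 * pi * of_int N + pi * y"
      by (simp add: algebra_simps)
    then show ?thesis by (simp only: cos_add cos_int_2pin sin_int_2pin mult_1 mult_zero_left diff_zero)
  qed
  have half: "1 / 2 \<le> cos (pi * y)" if "0 \<le> y" "y \<le> 1 / 3" for y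
  proof -
    have "cos (pi / 3) \<le> cos (pi * y)"
      using that by (intro cos_monotone_0_pi_le) auto
    then show ?thesis by (simp add: cos_60)
  qed
  from d consider "d = 0" | "d = 1" by auto
  then show ?thesis
  proof cases
    case 1
    then show ?thesis
      using periodic[of r] half[of r] r by (simp add: schoenberg_profile_def add.assoc)
  next
    case 2
    have "cos (pi * (2 / 3 + r)) = - cos (pi * (1 / 3 - r))"
    proof -
      have "pi * (2 / 3 + r) = pi - pi * (1 / 3 - r)" by (simp add: field_simps)
      then show ?thesis by (simp only: cos_pi_minus)
    qed
    then show ?thesis
      using 2 periodic[of "2 / 3 + r"] half[of "1 / 3 - r"] r
      by (simp add: schoenberg_profile_def add.assoc)
  qed
qed

text \<open>
  Schoenberg's curve: if \<open>s\<close> has only the ternary digits \<open>0\<close> and \<open>2\<close>, then the \<open>k\<close>-th binary digit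
  of coordinate \<open>i\<close> is half the ternary digit of \<open>s\<close> at the position \<open>prod_encode (i, k)\<close>. The weights start at \<open>1\<close> instead of \<open>1/2\<close>, so that the coordinates
  range over \<open>[0, 2]\<close>; only coordinates up to \<open>1\<close> are needed, and those are twice a number below
  \<open>1\<close>, whose binary digits can be computed by rounding down.
\<close>

definition hilbert_cube_curve :: "real \<Rightarrow> nat \<Rightarrow> real" where
  "hilbert_cube_curve s i = (\<Sum>k. (1 / 2) ^ k * schoenberg_profile (3 ^ prod_encode (i, k) * s))"

lemma hilbert_cube_curve_summand_bound:
  "norm ((1 / 2) ^ k * schoenberg_profile x) \<le> (1 / 2) ^ k"
  using schoenberg_profile_bounds[of x] by (simp add: mult_left_le)

lemma hilbert_cube_curve_bounds: "0 \<le> hilbert_cube_curve s i" "hilbert_cube_curve s i \<le> 2"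
proof -
  let ?f = "\<lambda>k. (1 / 2) ^ k * schoenberg_profile (3 ^ prod_encode (i, k) * s)"
  have geom: "(\<lambda>k. (1 / 2 :: real) ^ k) sums 2"
    using geometric_sums[of "1 / 2 :: real"] by simp
  have sm: "summable ?f"
    by (rule summable_comparison_test'[where N = 0, OF sums_summable[OF geom]])
      (rule hilbert_cube_curve_summand_bound)
  show "0 \<le> hilbert_cube_curve s i"
    unfolding hilbert_cube_curve_def by (intro suminf_nonneg sm) (simp add: schoenberg_profile_bounds)
  have "suminf ?f \<le> (\<Sum>k. (1 / 2 :: real) ^ k)"
    by (intro suminf_le sm sums_summable[OF geom]) (simp add: schoenberg_profile_bounds mult_left_le)
  then show "hilbert_cube_curve s i \<le> 2"
    using sums_unique[OF geom] by (simp add: hilbert_cube_curve_def)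
qed

lemma continuous_on_hilbert_cube_curve: "continuous_on S hilbert_cube_curve"
proof (rule continuous_on_coordinatewise_then_product)
  fix i
  let ?f = "\<lambda>k s. (1 / 2) ^ k * schoenberg_profile (3 ^ prod_encode (i, k) * s)"
  have "uniform_limit S (\<lambda>n s. \<Sum>k<n. ?f k s) (\<lambda>s. \<Sum>k. ?f k s) sequentially"
    by (rule Weierstrass_m_test[OF hilbert_cube_curve_summand_bound]) (simp add: summable_geometric)
  moreover have "continuous_on S (\<lambda>s. \<Sum>k<n. ?f k s)" for n
    by (intro continuous_intros continuous_on_compose2[OF continuous_on_schoenberg_profile[of UNIV]])
      auto
  ultimately show "continuous_on S (\<lambda>s. hilbert_cube_curve s i)"
    unfolding hilbert_cube_curve_def by (intro uniform_limit_theorem[rotated]) auto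
qed

lemma binary_digits_exist:
  fixes y :: real
  assumes "0 \<le> y" "y < 1"
  shows "\<exists>b. (\<forall>k. b k \<in> {0, 1 :: real}) \<and> (\<lambda>k. b k * (1 / 2) ^ Suc k) sums y"
proof -
  define q where "q k = \<lfloor>2 ^ k * y\<rfloor>" for k :: nat
  \<comment> \<open>The \<open>k\<close>-th digit compares two successive truncations, so partial sums telescope.\<close>
  define b where "b k = q (Suc k) - 2 * q k" for k
  have q: "of_int (q k) \<le> 2 ^ k * y" "2 ^ k * y < of_int (q k) + 1" for k
    unfolding q_def by linarith+
  have "b k \<in> {0, 1}" for k
  proof -
    have "real_of_int (b k) < 2" "- 1 < real_of_int (b k)"
      using q[of k] q[of "Suc k"] by (simp_all add: b_def)
    then show ?thesis by (simp add: b_def) linarith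
  qed
  moreover have partial: "(\<Sum>k<n. real_of_int (b k) * (1 / 2) ^ Suc k) = of_int (q n) / 2 ^ n" for n
  proof (induction n)
    case 0
    have "\<lfloor>y\<rfloor> = 0" using assms by (simp add: floor_eq_iff)
    then show ?case by (simp add: q_def)
  qed (simp add: b_def field_simps)
  have "(\<lambda>k. real_of_int (b k) * (1 / 2) ^ Suc k) sums y"
    unfolding sums_def partial
  proof (rule real_tendsto_sandwich)
    show "\<forall>\<^sub>F n in sequentially. y - (1 / 2) ^ n \<le> of_int (q n) / 2 ^ n"
    proof (intro always_eventually allI)
      fix n
      show "y - (1 / 2) ^ n \<le> of_int (q n) / 2 ^ n"
        using q(2)[of n] by (simp add: pos_le_divide_eq left_diff_distrib right_diff_distrib power_one_over mult.commute)
    qed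
    show "\<forall>\<^sub>F n in sequentially. of_int (q n) / 2 ^ n \<le> y"
      using q by (intro always_eventually allI) (simp add: field_simps)
    show "(\<lambda>n. y - (1 / 2) ^ n) \<longlonglongrightarrow> y"
      using tendsto_diff[OF tendsto_const LIMSEQ_realpow_zero[of "1 / 2"]] by force
  qed simp
  ultimately show ?thesis
    by (intro exI[of _ "\<lambda>k. real_of_int (b k)"]) (metis insertCI insertE of_int_0 of_int_1 singletonD)
qed

text \<open>
  Interleave the binary digits of all coordinates and use them as ternary digits. Multiplication by
  \<open>3 ^ n\<close> turns the digits before position \<open>n\<close> into an even integer, and the digits after it add at
  most \<open>1/3\<close>, so the profile returns the digit at \<open>n\<close>.
\<close>

lemma hilbert_cube_curve_covers:
  assumes u: "\<And>i. 0 \<le> u i \<and> u i \<le> 1"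
  shows "\<exists>s\<in>{0..1}. hilbert_cube_curve s = u"
proof -
  have "\<exists>b. (\<forall>k. b k \<in> {0, 1 :: real}) \<and> (\<lambda>k. b k * (1 / 2) ^ Suc k) sums (u i / 2)" for i
    using u[of i] by (intro binary_digits_exist) auto
  then obtain b where b01: "\<And>i k. b i k \<in> {0, 1 :: real}"
    and b_sums: "\<And>i. (\<lambda>k. b i k * (1 / 2) ^ Suc k) sums (u i / 2)"
    by metis
  define c where "c n = b (fst (prod_decode n)) (snd (prod_decode n))" for n
  have c01: "c n \<in> {0, 1}" for n unfolding c_def by (rule b01)
  have c_bounds: "0 \<le> c n" "c n \<le> 1" for n using c01[of n] by auto
  define f where "f n = 2 * c n * (1 / 3) ^ Suc n" for n
  have geom: "(\<lambda>n. 2 * (1 / 3 :: real) ^ Suc n) sums 1"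
    using sums_mult[OF geometric_sums[of "1 / 3 :: real"], of "2 / 3"] by simp
  have f_bounds: "0 \<le> f n" "f n \<le> 2 * (1 / 3) ^ Suc n" for n
    using c_bounds[of n] by (auto simp: f_def mult_left_le)
  have f_sm: "summable f"
    by (rule summable_comparison_test'[where N = 0, OF sums_summable[OF geom]])
      (use f_bounds in auto)
  define s where "s = suminf f"
  have digit: "schoenberg_profile (3 ^ n * s) = c n" for n
  proof -
    define r where "r = 3 ^ n * (\<Sum>k. f (k + Suc n))"
    have tail_geom: "(\<lambda>k. 2 * (1 / 3 :: real) ^ Suc (k + Suc n)) sums ((1 / 3) ^ Suc n)"
      using sums_mult[OF geom, of "(1 / 3) ^ Suc n"] by (simp add: power_add field_simps)
    have tail_sm: "summable (\<lambda>k. f (k + Suc n))"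
      using f_sm by (rule summable_ignore_initial_segment)
    have "(\<Sum>k. f (k + Suc n)) \<le> (1 / 3) ^ Suc n"
      using suminf_le[OF f_bounds(2) tail_sm sums_summable[OF tail_geom]] sums_unique[OF tail_geom]
      by simp
    then have r: "0 \<le> r" "r \<le> 1 / 3"
      using suminf_nonneg[OF tail_sm f_bounds(1)] by (auto simp: r_def field_simps)
    have "\<exists>N::int. 3 ^ n * (\<Sum>k<n. f k) = 2 * of_int N"
    proof (induction n)
      case (Suc n)
      then obtain N :: int where N: "3 ^ n * (\<Sum>k<n. f k) = 2 * of_int N" by blast
      have "\<exists>d::int. c n = of_int d" using c01[of n] by (metis insertE of_int_0 of_int_1 singletonD)
      then obtain d :: int where d: "c n = of_int d" by blast
      have "3 ^ Suc n * (\<Sum>k<Suc n. f k) = 3 * (3 ^ n * (\<Sum>k<n. f k)) + 2 * c n"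
        by (simp add: f_def field_simps)
      also have "\<dots> = 2 * of_int (3 * N + d)" using N d by simp
      finally show ?case by blast
    qed simp
    then obtain N :: int where N: "3 ^ n * (\<Sum>k<n. f k) = 2 * of_int N" by blast
    have "s = (\<Sum>k. f (k + Suc n)) + (\<Sum>k<Suc n. f k)"
      unfolding s_def by (rule suminf_split_initial_segment[OF f_sm])
    then have "3 ^ n * s = 3 ^ n * (\<Sum>k<n. f k) + 3 ^ n * f n + r"
      by (simp add: r_def algebra_simps)
    also have "\<dots> = 2 * of_int N + 2 * c n / 3 + r"
      by (simp only: N) (simp add: f_def flip: power_mult_distrib)
    finally show ?thesis
      using schoenberg_profile_digit[OF r c01[of n]] by simp
  qed
  have "hilbert_cube_curve s i = u i" for i
  proof -
    have "(\<lambda>k. (1 / 2) ^ k * schoenberg_profile (3 ^ prod_encode (i, k) * s)) sums u i"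
      unfolding digit c_def using sums_mult[OF b_sums[of i], of 2] by (simp add: mult.commute)
    then show ?thesis by (simp add: hilbert_cube_curve_def sums_iff)
  qed
  moreover have "0 \<le> s" "s \<le> 1"
    using suminf_nonneg[OF f_sm f_bounds(1)] suminf_le[OF f_bounds(2) f_sm sums_summable[OF geom]]
      sums_unique[OF geom] by (auto simp: s_def)
  ultimately show ?thesis by (intro bexI[of _ s] ext) simp_all
qed

section \<open>A limit measure on the line\<close>

context bounded_psd_state
begin

text \<open>
  The grid measures are transported to points of \<open>[0, 1]\<close> that the curve maps to the nodes. These
  measures are tight because the interval is bounded, which reduces weak compactness in the cube to Helly's
  theorem on the line.
\<close>

lemma limit_measure:
  "\<exists>M. real_distribution M \<and>
    (\<forall>x f. polynomial_lift t I x f \<longrightarrow> (\<integral>s. f (hilbert_cube_curve s) \<partial>M) = L x)"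
proof -
  have "\<exists>s\<in>{0..1}. hilbert_cube_curve s = node n k" if "k \<in> grid n" for n k
    using node_bounds[OF that] by (rule hilbert_cube_curve_covers)
  then have ex: "\<exists>s. s \<in> {0..1} \<and> hilbert_cube_curve s = node n k" if "k \<in> grid n" for n k
    using that by blast
  define \<sigma> where "\<sigma> n k = (SOME s. s \<in> {0..1} \<and> hilbert_cube_curve s = node n k)" for n k
  have \<sigma>: "\<sigma> n k \<in> {0..1}" "hilbert_cube_curve (\<sigma> n k) = node n k" if "k \<in> grid n" for n k
    using someI_ex[OF ex[OF that]] unfolding \<sigma>_def by blast+
  define P where "P n = point_measure (grid n) (\<lambda>k. ennreal (L (weight n k)))" for n
  define \<mu> where "\<mu> n = distr (P n) borel (\<sigma> n)" for n
  have weight_nonneg: "0 \<le> L (weight n k)" for n k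
    by (rule L_nonneg[OF L_pos_weight])
  have "(\<Sum>k\<in>grid n. L (weight n k)) = 1" for n
    using sum_weight[of n] unit by (simp flip: L_sum)
  then have "(\<Sum>k\<in>grid n. ennreal (L (weight n k))) = 1" for n
    by (subst sum_ennreal) (simp_all add: weight_nonneg)
  then have prob_P: "prob_space (P n)" for n
    unfolding P_def by (intro prob_space_point_measure finite_grid) simp_all
  have space_P: "space (P n) = grid n" for n
    by (simp add: P_def space_point_measure)
  have \<sigma>_measurable: "\<sigma> n \<in> borel_measurable (P n)" for n
    unfolding P_def by (simp add: measurable_point_measure_eq1)
  have \<mu>_dist: "real_distribution (\<mu> n)" for n
    unfolding \<mu>_def by (intro prob_space.real_distribution_distr prob_P \<sigma>_measurable)
  have "tight \<mu>"
    unfolding tight_def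
  proof (intro conjI allI impI \<mu>_dist)
    fix \<epsilon> :: real
    assume "0 < \<epsilon>"
    have "measure (\<mu> n) {- 1<..1} = 1" for n
    proof -
      have "\<sigma> n -` {- 1<..1} \<inter> space (P n) = space (P n)"
        using \<sigma>(1)[of _ n] by (force simp: space_P)
      then show ?thesis
        using prob_space.prob_space[OF prob_P]
        by (simp add: \<mu>_def measure_distr[OF \<sigma>_measurable])
    qed
    then show "\<exists>a b. a < b \<and> (\<forall>n. 1 - \<epsilon> < measure (\<mu> n) {a<..b})"
      using \<open>0 < \<epsilon>\<close> by (intro exI[of _ "- 1"] exI[of _ 1]) simp
  qed
  then obtain r M where r: "strict_mono (r :: nat \<Rightarrow> nat)" and M: "real_distribution M"
    and conv: "weak_conv_m (\<mu> \<circ> id \<circ> r) M"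
    using tight_imp_convergent_subsubsequence[of \<mu> id] strict_mono_id by blast
  have "(\<integral>s. f (hilbert_cube_curve s) \<partial>M) = L x" if lift: "polynomial_lift t I x f" for x f
  proof -
    let ?F = "\<lambda>s. f (hilbert_cube_curve s)"
    have cont: "continuous_on UNIV ?F"
      by (rule continuous_on_compose2[OF continuous_on_polynomial_lift[OF lift]
            continuous_on_hilbert_cube_curve]) simp
    obtain C where C: "\<And>u. \<forall>i. 0 \<le> u i \<and> u i \<le> 2 \<Longrightarrow> \<bar>f u\<bar> \<le> C"
      using polynomial_lift_bounded[OF lift] by blast
    have "norm (?F s) \<le> C" for s
      using C[of "hilbert_cube_curve s"] hilbert_cube_curve_bounds by simp
    moreover have "isCont ?F s" for s
      using cont by (simp add: continuous_on_eq_continuous_at)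
    ultimately have lim1: "(\<lambda>n. integral\<^sup>L ((\<mu> \<circ> id \<circ> r) n) ?F) \<longlonglongrightarrow> integral\<^sup>L M ?F"
      by (intro weak_conv_imp_integral_bdd_continuous_conv[OF _ M conv, where B = C])
        (simp_all add: \<mu>_dist)
    have "integral\<^sup>L (\<mu> n) ?F = (\<Sum>k\<in>grid n. f (node n k) * L (weight n k))" for n
    proof -
      have "integral\<^sup>L (\<mu> n) ?F = (\<integral>k. ?F (\<sigma> n k) \<partial>P n)"
        unfolding \<mu>_def
        by (intro integral_distr \<sigma>_measurable borel_measurable_continuous_onI[OF cont])
      also have "\<dots> = (\<Sum>k\<in>grid n. L (weight n k) *\<^sub>R ?F (\<sigma> n k))"
        unfolding P_def by (intro lebesgue_integral_point_measure_finite finite_grid weight_nonneg)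
      finally show ?thesis by (simp add: \<sigma>(2) mult.commute)
    qed
    then have lim2: "(\<lambda>n. integral\<^sup>L ((\<mu> \<circ> id \<circ> r) n) ?F) \<longlonglongrightarrow> L x"
      using LIMSEQ_subseq_LIMSEQ[OF grid_sum_tendsto[OF lift] r] by (simp add: o_def)
    show ?thesis by (rule LIMSEQ_unique[OF lim1 lim2])
  qed
  with M show ?thesis by blast
qed

end

section \<open>The space of characters\<close>

lemma closed_character_space: "closed (character_space :: ('a::{real_algebra_1,comm_ring_1} \<Rightarrow> real) set)"
proof -
  have coord: "continuous_on UNIV (\<lambda>\<alpha> :: 'a \<Rightarrow> real. \<alpha> x)" for x
    by (rule continuous_on_product_coordinates)
  have eq: "character_space = {\<alpha> :: 'a \<Rightarrow> real. (\<forall>x y. \<alpha> (x + y) = \<alpha> x + \<alpha> y) \<and>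
      (\<forall>r x. \<alpha> (r *\<^sub>R x) = r * \<alpha> x) \<and> \<alpha> 1 = 1 \<and> (\<forall>x y. \<alpha> (x * y) = \<alpha> x * \<alpha> y)}"
    by (auto simp: character_space_def linear_add linear_scale intro!: linearI)
  show ?thesis
    unfolding eq
    by (intro closed_Collect_conj closed_Collect_all closed_Collect_eq continuous_on_add
        continuous_on_mult continuous_on_const coord)
qed

lemma compact_pointwise_bounded:
  fixes F :: "('i \<Rightarrow> real) set"
  assumes "closed F" and bound: "\<And>\<alpha> x. \<alpha> \<in> F \<Longrightarrow> \<bar>\<alpha> x\<bar> \<le> C x"
  shows "compact F"
proof -
  let ?box = "PiE UNIV (\<lambda>x. {- C x..C x})"
  have "compactin (product_topology (\<lambda>_. euclidean) UNIV) ?box"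
    by (simp add: compactin_PiE)
  then have "compact ?box"
    by (simp add: euclidean_product_topology)
  moreover have "F = ?box \<inter> F"
    using bound by (auto simp: PiE_iff abs_le_iff minus_le_iff)
  ultimately show ?thesis
    using compact_Int_closed[OF _ \<open>closed F\<close>] by metis
qed

text \<open>
  This is the Hausdorff property of the product topology. The index type may be uncountable, hence
  the detour through the abstract topology.
\<close>

lemma compact_imp_closed_pointwise:
  fixes K :: "('i \<Rightarrow> real) set"
  assumes "compact K"
  shows "closed K"
proof -
  have "Hausdorff_space (euclidean :: ('i \<Rightarrow> real) topology)"
    unfolding euclidean_product_topology[symmetric] by (simp add: Hausdorff_space_product_topology)
  then have "closedin euclidean K"
    using assms by (intro compactin_imp_closedin) auto
  then show ?thesis by simp
qed

lemma open_character_sets: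
  assumes "sets \<nu> = sets (restrict_space borel character_space)" "open U"
  shows "U \<inter> character_space \<in> sets \<nu>"
proof -
  have "character_space \<inter> U \<in> sets (restrict_space borel character_space)"
    unfolding sets_restrict_space using assms(2) by (intro imageI borel_open)
  then show ?thesis by (simp only: assms(1) Int_commute)
qed

lemma compact_character_sets:
  assumes "sets \<nu> = sets (restrict_space borel character_space)" "compact K" "K \<subseteq> character_space"
  shows "K \<in> sets \<nu>"
proof -
  have "character_space \<inter> K \<in> sets (restrict_space borel character_space)"
    unfolding sets_restrict_space
    by (intro imageI borel_closed compact_imp_closed_pointwise assms(2))
  then show ?thesis using assms(3) by (simp only: assms(1) Int_absorb1)
qed

lemma closed_measure_support:
  assumes "space \<mu> = X" "closed X"
  shows "closed (measure_support \<mu>)"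
proof -
  have "measure_support \<mu> = X - \<Union> {U. open U \<and> \<not> emeasure \<mu> (U \<inter> X) > 0}"
    using assms(1) by (auto simp: measure_support_def)
  then show ?thesis using assms(2) by (auto intro: closed_Diff)
qed

lemma character_spaceD:
  assumes "\<alpha> \<in> character_space"
  shows "linear \<alpha>" "\<alpha> 1 = 1" "\<alpha> (x * y) = \<alpha> x * \<alpha> y" "\<alpha> (x + y) = \<alpha> x + \<alpha> y"
    "\<alpha> (x - y) = \<alpha> x - \<alpha> y" "\<alpha> (of_real r) = r" "\<alpha> (x\<^sup>2) = (\<alpha> x)\<^sup>2"
proof -
  show lin: "linear \<alpha>" and one: "\<alpha> 1 = 1" and mult: "\<alpha> (x * y) = \<alpha> x * \<alpha> y" for x y
    using assms by (auto simp: character_space_def)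
  show "\<alpha> (x + y) = \<alpha> x + \<alpha> y" "\<alpha> (x - y) = \<alpha> x - \<alpha> y"
    using lin by (simp_all add: linear_add linear_diff)
  show "\<alpha> (of_real r) = r"
    using linear_scale[OF lin, of r 1] one by (simp add: scaleR_conv_of_real)
  show "\<alpha> (x\<^sup>2) = (\<alpha> x)\<^sup>2"
    by (simp add: power2_eq_square mult)
qed

text \<open>
  The embedding of the characters into a metrizable space, in which distance functions are available.
\<close>

definition coordinates :: "(nat \<Rightarrow> 'a) \<Rightarrow> nat set \<Rightarrow> ('a \<Rightarrow> real) \<Rightarrow> nat \<Rightarrow> real" where
  "coordinates t I \<alpha> i = (if i \<in> I then \<alpha> (t i) else 0)"

lemma continuous_on_coordinates: "continuous_on S (coordinates t I)"
proof (rule continuous_on_coordinatewise_then_product)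
  fix i
  have "continuous_on S (\<lambda>\<alpha>. if i \<in> I then \<alpha> (t i) else (0::real))"
    by (cases "i \<in> I") (auto intro: continuous_on_subset[OF continuous_on_product_coordinates])
  then show "continuous_on S (\<lambda>\<alpha>. coordinates t I \<alpha> i)"
    by (simp add: coordinates_def)
qed

lemma character_eq_polynomial_lift:
  assumes "polynomial_lift t I x f" and \<alpha>: "\<alpha> \<in> character_space"
  shows "\<alpha> x = f (coordinates t I \<alpha>)"
  using assms(1)
  by (induction rule: polynomial_lift.induct) (auto simp: character_spaceD[OF \<alpha>] coordinates_def)

lemma inj_on_coordinates:
  assumes "generates_algebra (t ` I)"
  shows "inj_on (coordinates t I) character_space"
proof (rule inj_onI)
  fix \<alpha> \<beta> :: "'a \<Rightarrow> real"
  assume "\<alpha> \<in> character_space" "\<beta> \<in> character_space" "coordinates t I \<alpha> = coordinates t I \<beta>"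
  then have "\<alpha> x = \<beta> x" for x
    using polynomial_lift_exists[OF assms, of x] by (metis character_eq_polynomial_lift)
  then show "\<alpha> = \<beta>" by (rule ext)
qed

section \<open>Existence of a representing measure\<close>

context bounded_psd_state
begin

text \<open>
  The parameters at which the curve satisfies every polynomial relation between the generators, so
  that evaluation there is well defined on the algebra.
\<close>

definition relation_variety :: "real set" where
  "relation_variety = {s. \<forall>g. polynomial_lift t I 0 g \<longrightarrow> g (hilbert_cube_curve s) = 0}"

text \<open>
  Different representatives of \<open>x\<close> take different values in general, but not on \<open>relation_variety\<close>.
\<close>

definition lift_of :: "'a \<Rightarrow> (nat \<Rightarrow> real) \<Rightarrow> real" where
  "lift_of x = (SOME f. polynomial_lift t I x f)"

definition curve_character :: "real \<Rightarrow> 'a \<Rightarrow> real" where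
  "curve_character s x = lift_of x (hilbert_cube_curve s)"

lemma polynomial_lift_lift_of: "polynomial_lift t I x (lift_of x)"
  unfolding lift_of_def using polynomial_lift_exists[OF generates] by (rule someI_ex)

lemma continuous_on_lift_curve:
  "polynomial_lift t I x f \<Longrightarrow> continuous_on UNIV (\<lambda>s. f (hilbert_cube_curve s))"
  by (rule continuous_on_compose2[OF continuous_on_polynomial_lift continuous_on_hilbert_cube_curve])
    simp_all

lemma continuous_on_curve_character: "continuous_on S curve_character"
  unfolding curve_character_def[abs_def]
  by (rule continuous_on_coordinatewise_then_product)
    (rule continuous_on_subset[OF continuous_on_lift_curve[OF polynomial_lift_lift_of] subset_UNIV])

lemma curve_character_eq:
  assumes "s \<in> relation_variety" "polynomial_lift t I x f"
  shows "curve_character s x = f (hilbert_cube_curve s)"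
proof -
  have "polynomial_lift t I (x + of_real (- 1) * x) (\<lambda>u. f u + (- 1) * lift_of x u)"
    by (intro lift_add lift_scale assms(2) polynomial_lift_lift_of)
  then show ?thesis
    using assms(1) by (force simp: relation_variety_def curve_character_def)
qed

lemma curve_character_in_character_space:
  assumes "s \<in> relation_variety"
  shows "curve_character s \<in> character_space"
  unfolding character_space_def
proof (intro CollectI conjI allI)
  note eq = curve_character_eq[OF assms] and lift = polynomial_lift_lift_of
  show "linear (curve_character s)"
  proof (rule linearI)
    show "curve_character s (x + y) = curve_character s x + curve_character s y" for x y
      using eq[OF lift_add[OF lift lift]] by (simp add: curve_character_def)
    show "curve_character s (r *\<^sub>R x) = r *\<^sub>R curve_character s x" for r x
      using eq[OF lift_scale[OF lift]] by (simp add: curve_character_def scaleR_conv_of_real)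
  qed
  show "curve_character s 1 = 1"
    using eq[OF lift_one] .
  show "curve_character s (x * y) = curve_character s x * curve_character s y" for x y
    using eq[OF lift_mult[OF lift lift]] by (simp add: curve_character_def)
qed

lemma curve_character_bounded: "\<exists>C. \<forall>s. \<bar>curve_character s x\<bar> \<le> C"
  unfolding curve_character_def
  using polynomial_lift_bounded[OF polynomial_lift_lift_of[of x]] hilbert_cube_curve_bounds by blast

definition relation_complements :: "real set set" where
  "relation_complements = {{s. g (hilbert_cube_curve s) \<noteq> 0} | g. polynomial_lift t I 0 g}"

lemma relation_variety_eq: "relation_variety = - \<Union> relation_complements"
  by (auto simp: relation_variety_def relation_complements_def)

lemma open_relation_complements: "U \<in> relation_complements \<Longrightarrow> open U"
  unfolding relation_complements_def
  by (auto intro!: open_Collect_neq continuous_on_const continuous_on_lift_curve)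

lemma closed_relation_variety: "closed relation_variety"
  unfolding relation_variety_eq by (auto intro: open_relation_complements)

text \<open>
  For a single relation \<open>g\<close> the integral of \<open>g\<^sup>2\<close> is \<open>L 0\<close>. There may be uncountably many relations,
  but their complements are open, so countably many of them suffice by Lindeloef's theorem.
\<close>

lemma AE_relation_variety:
  assumes M: "real_distribution M"
    and moments: "\<And>x f. polynomial_lift t I x f \<Longrightarrow> (\<integral>s. f (hilbert_cube_curve s) \<partial>M) = L x"
  shows "AE s in M. s \<in> relation_variety"
proof -
  interpret M: real_distribution M by (rule M)
  obtain F where F: "F \<subseteq> relation_complements" "countable F"
    "\<Union> F = \<Union> relation_complements"
    using Lindelof[of relation_complements] open_relation_complements by metis
  have "AE s in M. s \<notin> U" if U: "U \<in> relation_complements" for U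
  proof -
    obtain g where g: "polynomial_lift t I 0 g" "U = {s. g (hilbert_cube_curve s) \<noteq> 0}"
      using U by (auto simp: relation_complements_def)
    let ?F = "\<lambda>s. g (hilbert_cube_curve s) * g (hilbert_cube_curve s)"
    have lift: "polynomial_lift t I 0 (\<lambda>u. g u * g u)"
      using lift_mult[OF g(1) g(1)] by simp
    obtain C where C: "\<And>u. \<forall>i. 0 \<le> u i \<and> u i \<le> 2 \<Longrightarrow> \<bar>g u * g u\<bar> \<le> C"
      using polynomial_lift_bounded[OF lift] by blast
    have "integrable M ?F"
    proof (rule M.integrable_const_bound)
      show "AE s in M. norm (?F s) \<le> C"
        using C[of "hilbert_cube_curve _"] hilbert_cube_curve_bounds by simp
      show "?F \<in> borel_measurable M"
        using borel_measurable_continuous_onI[OF continuous_on_lift_curve[OF lift]] by simp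
    qed
    moreover have "integral\<^sup>L M ?F = 0"
      using moments[OF lift] by (simp add: L_zero)
    ultimately have "AE s in M. ?F s = 0"
      using integral_nonneg_eq_0_iff_AE[of M ?F] by simp
    then show ?thesis by (simp add: g(2))
  qed
  then have "AE s in M. \<forall>U\<in>F. s \<notin> U"
    using F(1) by (subst AE_ball_countable[OF F(2)]) blast
  then show ?thesis
    using F(3) unfolding relation_variety_eq by (elim AE_mp) (intro AE_I2, blast)
qed

text \<open>
  Parameters outside \<open>relation_variety\<close> form a null set and are sent to an arbitrary character. Inner
  regularity passes from the line to the image measure because the parametrisation is continuous on
  the variety and so maps compact sets to compact sets. Compactness of the support is Tychonoff's
  theorem: each evaluation is bounded along the curve.
\<close>

theorem representing_measure_exists:
  assumes nonempty: "character_space \<noteq> ({} :: ('a \<Rightarrow> real) set)"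
  shows "\<exists>\<nu>. representing_measure L \<nu> \<and> compact (measure_support \<nu>)"
proof -
  let ?X = "character_space :: ('a \<Rightarrow> real) set" and ?S = relation_variety
  obtain \<alpha>\<^sub>0 where \<alpha>\<^sub>0: "\<alpha>\<^sub>0 \<in> ?X" using nonempty by blast
  obtain M where M: "real_distribution M"
    and moments: "\<And>x f. polynomial_lift t I x f \<Longrightarrow> (\<integral>s. f (hilbert_cube_curve s) \<partial>M) = L x"
    using limit_measure by blast
  interpret M: real_distribution M by (rule M)
  note ae = AE_relation_variety[OF M moments]
  define \<theta> where "\<theta> s = (if s \<in> ?S then curve_character s else \<alpha>\<^sub>0)" for s
  have S_borel: "?S \<in> sets borel"
    by (rule borel_closed[OF closed_relation_variety])
  have "\<theta> \<in> borel_measurable borel"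
    unfolding \<theta>_def
    by (intro measurable_If_set borel_measurable_continuous_onI continuous_on_curve_character)
      (simp_all add: S_borel)
  moreover have "\<theta> s \<in> ?X" for s
    by (simp add: \<theta>_def \<alpha>\<^sub>0 curve_character_in_character_space)
  ultimately have \<theta>_measurable: "\<theta> \<in> M \<rightarrow>\<^sub>M restrict_space borel ?X"
    by (intro measurable_restrict_space2) auto
  define \<nu> where "\<nu> = distr M (restrict_space borel ?X) \<theta>"
  have sets_\<nu>: "sets \<nu> = sets (restrict_space borel ?X)"
    by (simp add: \<nu>_def)
  have space_\<nu>: "space \<nu> = ?X"
    by (simp add: \<nu>_def space_restrict_space)
  interpret \<nu>: prob_space \<nu>
    unfolding \<nu>_def by (rule M.prob_space_distr[OF \<theta>_measurable])
  have emeasure_\<nu>: "emeasure \<nu> B = emeasure M (\<theta> -` B)" if "B \<in> sets \<nu>" for B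
    using emeasure_distr[OF \<theta>_measurable, of B] that by (simp add: \<nu>_def)
  have preimage_borel: "\<theta> -` B \<in> sets borel" if "B \<in> sets \<nu>" for B
    using measurable_sets[OF \<theta>_measurable, of B] that by (simp add: sets_\<nu>)
  note open_in_sets = open_character_sets[OF sets_\<nu>]
  note compact_in_sets = compact_character_sets[OF sets_\<nu>]
  have inner: "emeasure \<nu> B = (SUP K\<in>{K. compact K \<and> K \<subseteq> B}. emeasure \<nu> K)"
    if B: "B \<in> sets \<nu>" for B
  proof (rule antisym)
    have BX: "B \<subseteq> ?X" using sets.sets_into_space[OF B] by (simp add: space_\<nu>)
    have "emeasure \<nu> B = emeasure M (\<theta> -` B \<inter> ?S)"
      unfolding emeasure_\<nu>[OF B] using ae preimage_borel[OF B] S_borel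
      by (intro emeasure_eq_AE) auto
    also have "\<dots> = (SUP K\<in>{K. K \<subseteq> \<theta> -` B \<inter> ?S \<and> compact K}. emeasure M K)"
      using preimage_borel[OF B] S_borel M.emeasure_finite by (intro inner_regular) auto
    also have "\<dots> \<le> (SUP K\<in>{K. compact K \<and> K \<subseteq> B}. emeasure \<nu> K)"
    proof (rule SUP_least)
      fix K
      assume "K \<in> {K. K \<subseteq> \<theta> -` B \<inter> ?S \<and> compact K}"
      then have K: "K \<subseteq> \<theta> -` B" "K \<subseteq> ?S" "compact K" by auto
      then have "\<theta> ` K = curve_character ` K" by (auto simp: \<theta>_def)
      then have image: "compact (\<theta> ` K)"
        using compact_continuous_image[OF continuous_on_curve_character K(3)] by simp
      have subset: "\<theta> ` K \<subseteq> B" using K(1) by blast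
      then have \<theta>K: "\<theta> ` K \<in> sets \<nu>" using BX by (intro compact_in_sets image) auto
      have "emeasure M K \<le> emeasure \<nu> (\<theta> ` K)"
        unfolding emeasure_\<nu>[OF \<theta>K] using preimage_borel[OF \<theta>K] by (intro emeasure_mono) auto
      then show "emeasure M K \<le> (SUP K\<in>{K. compact K \<and> K \<subseteq> B}. emeasure \<nu> K)"
        using image subset by (intro SUP_upper2[of "\<theta> ` K"]) auto
    qed
    finally show "emeasure \<nu> B \<le> (SUP K\<in>{K. compact K \<and> K \<subseteq> B}. emeasure \<nu> K)" .
    show "(SUP K\<in>{K. compact K \<and> K \<subseteq> B}. emeasure \<nu> K) \<le> emeasure \<nu> B"
      using B by (intro SUP_least emeasure_mono) auto
  qed
  have "radon_on_characters \<nu>"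
    unfolding radon_on_characters_def
  proof (intro conjI ballI)
    show "\<exists>U. open U \<and> \<alpha> \<in> U \<and> emeasure \<nu> (U \<inter> ?X) < \<infinity>" for \<alpha>
      by (intro exI[of _ UNIV]) (simp add: less_top[symmetric])
  qed (use sets_\<nu> inner in auto)
  moreover have "integrable \<nu> (\<lambda>\<alpha>. \<alpha> x) \<and> L x = (\<integral>\<alpha>. \<alpha> x \<partial>\<nu>)" for x
  proof
    have eval: "(\<lambda>\<alpha>. \<alpha> x) \<in> borel_measurable (restrict_space borel ?X)"
      by (intro measurable_restrict_space1 borel_measurable_continuous_onI) simp
    obtain C where C: "\<And>s. \<bar>curve_character s x\<bar> \<le> C"
      using curve_character_bounded by blast
    have ae_eq: "AE s in M. \<theta> s x = lift_of x (hilbert_cube_curve s)"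
      using ae by (rule AE_mp) (auto simp: \<theta>_def curve_character_def)
    have lift_measurable: "(\<lambda>s. lift_of x (hilbert_cube_curve s)) \<in> borel_measurable M"
      using borel_measurable_continuous_onI[OF continuous_on_lift_curve[OF polynomial_lift_lift_of]]
      by simp
    have \<theta>x_measurable: "(\<lambda>s. \<theta> s x) \<in> borel_measurable M"
      using measurable_compose[OF \<theta>_measurable eval] .
    have "integrable M (\<lambda>s. \<theta> s x)"
    proof (rule M.integrable_const_bound)
      show "AE s in M. norm (\<theta> s x) \<le> C"
        using ae_eq by (rule AE_mp) (use C in \<open>auto simp: curve_character_def\<close>)
    qed (rule \<theta>x_measurable)
    then show "integrable \<nu> (\<lambda>\<alpha>. \<alpha> x)"
      unfolding \<nu>_def by (simp add: integrable_distr_eq[OF \<theta>_measurable eval])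
    have "(\<integral>\<alpha>. \<alpha> x \<partial>\<nu>) = (\<integral>s. \<theta> s x \<partial>M)"
      unfolding \<nu>_def by (rule integral_distr[OF \<theta>_measurable eval])
    also have "\<dots> = (\<integral>s. lift_of x (hilbert_cube_curve s) \<partial>M)"
      by (rule integral_cong_AE[OF \<theta>x_measurable lift_measurable ae_eq])
    also have "\<dots> = L x" by (rule moments[OF polynomial_lift_lift_of])
    finally show "L x = (\<integral>\<alpha>. \<alpha> x \<partial>\<nu>)" ..
  qed
  moreover have "compact (measure_support \<nu>)"
  proof -
    obtain C where C: "\<And>x s. \<bar>curve_character s x\<bar> \<le> C x"
      using curve_character_bounded by metis
    have "\<bar>\<alpha> x\<bar> \<le> C x" if \<alpha>: "\<alpha> \<in> measure_support \<nu>" for \<alpha> x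
    proof (rule ccontr)
      let ?U = "{\<beta> :: 'a \<Rightarrow> real. C x < \<bar>\<beta> x\<bar>}"
      assume "\<not> \<bar>\<alpha> x\<bar> \<le> C x"
      then have "\<alpha> \<in> ?U" by simp
      moreover have U: "open ?U"
        by (intro open_Collect_less continuous_on_const continuous_on_rabs) simp
      ultimately have "emeasure \<nu> (?U \<inter> ?X) > 0"
        using \<alpha> by (auto simp: measure_support_def space_\<nu>)
      moreover have "emeasure M (\<theta> -` (?U \<inter> ?X)) = 0"
      proof -
        have "AE s in M. s \<in> \<theta> -` (?U \<inter> ?X) \<longleftrightarrow> s \<in> {}"
          using ae by (rule AE_mp) (use C in \<open>auto simp: \<theta>_def not_less\<close>)
        then have "emeasure M (\<theta> -` (?U \<inter> ?X)) = emeasure M {}"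
          using preimage_borel[OF open_in_sets[OF U]] by (intro emeasure_eq_AE) simp_all
        then show ?thesis by simp
      qed
      ultimately show False using emeasure_\<nu>[OF open_in_sets[OF U]] by simp
    qed
    then show ?thesis
      by (intro compact_pointwise_bounded[of _ C]
          closed_measure_support[OF space_\<nu> closed_character_space])
  qed
  ultimately show ?thesis unfolding representing_measure_def by blast
qed

end

section \<open>Compactly supported representing measures\<close>

text \<open>
  The Stone--Weierstrass theorem on the compact image of \<open>K\<close> under the coordinates, for the algebra
  of polynomial functions in the coordinates.
\<close>

lemma approximation_by_algebra_element:
  fixes f :: "(nat \<Rightarrow> real) \<Rightarrow> real"
  assumes generates: "generates_algebra (t ` I)"
    and K: "compact K" "K \<subseteq> character_space"
    and f: "continuous_on UNIV f" and e: "0 < e"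
  shows "\<exists>x. \<forall>\<alpha>\<in>K. \<bar>f (coordinates t I \<alpha>) - \<alpha> x\<bar> < e"
proof -
  let ?\<phi> = "coordinates t I"
  define P where "P g \<longleftrightarrow> (\<exists>x. polynomial_lift t I x g)" for g
  have "\<exists>g. P g \<and> (\<forall>u\<in>?\<phi> ` K. \<bar>f u - g u\<bar> < e)"
  proof (rule Stone_Weierstrass_HOL[where P = P])
    show "compact (?\<phi> ` K)"
      by (rule compact_continuous_image[OF continuous_on_coordinates K(1)])
    show "P (\<lambda>_. c)" for c
      using lift_scale[OF lift_one, of t I c] by (auto simp: P_def)
    show "continuous_on (?\<phi> ` K) g" if "P g" for g
      using that unfolding P_def
      by (auto intro: continuous_on_subset[OF continuous_on_polynomial_lift subset_UNIV])
    show "P (\<lambda>u. g u + h u)" "P (\<lambda>u. g u * h u)" if "P g \<and> P h" for g h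
      using that lift_add lift_mult by (fastforce simp: P_def)+
    show "\<exists>g. P g \<and> g u \<noteq> g v" if uv: "u \<in> ?\<phi> ` K \<and> v \<in> ?\<phi> ` K \<and> u \<noteq> v" for u v
    proof -
      obtain i where i: "u i \<noteq> v i" using uv by (auto simp: fun_eq_iff)
      then have "i \<in> I" using uv by (auto simp: coordinates_def)
      then show ?thesis
        using i by (intro exI[of _ "\<lambda>u. u i"]) (auto simp: P_def intro: lift_generator)
    qed
    show "continuous_on (?\<phi> ` K) f" by (rule continuous_on_subset[OF f subset_UNIV])
  qed (rule e)
  then obtain g x where "polynomial_lift t I x g" "\<And>\<alpha>. \<alpha> \<in> K \<Longrightarrow> \<bar>f (?\<phi> \<alpha>) - g (?\<phi> \<alpha>)\<bar> < e"
    by (auto simp: P_def)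
  then show ?thesis
    using K(2) by (intro exI[of _ x] ballI) (metis character_eq_polynomial_lift subsetD)
qed

locale compact_representation = psd_state L for L :: "'a::{real_algebra_1,comm_ring_1} \<Rightarrow> real" +
  fixes \<nu> :: "('a \<Rightarrow> real) measure"
  assumes representing: "representing_measure L \<nu>"
    and compact_support: "compact (measure_support \<nu>)"
begin

lemma radon: "radon_on_characters \<nu>"
  and integrable_eval: "integrable \<nu> (\<lambda>\<alpha>. \<alpha> x)"
  and L_eq_integral: "L x = (\<integral>\<alpha>. \<alpha> x \<partial>\<nu>)"
  using representing by (auto simp: representing_measure_def)

lemma sets_eq: "sets \<nu> = sets (restrict_space borel character_space)"
  and inner_regularity: "B \<in> sets \<nu> \<Longrightarrow> emeasure \<nu> B = (SUP K\<in>{K. compact K \<and> K \<subseteq> B}. emeasure \<nu> K)"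
  using radon by (auto simp: radon_on_characters_def)

lemma space_eq: "space \<nu> = character_space"
  using sets_eq_imp_space_eq[OF sets_eq] by (simp add: space_restrict_space)

lemma open_Int_sets: "open U \<Longrightarrow> U \<inter> character_space \<in> sets \<nu>"
  by (rule open_character_sets[OF sets_eq])

lemma continuous_measurable: "continuous_on UNIV f \<Longrightarrow> f \<in> borel_measurable \<nu>"
  for f :: "('a \<Rightarrow> real) \<Rightarrow> real"
  unfolding measurable_cong_sets[OF sets_eq refl]
  by (intro measurable_restrict_space1 borel_measurable_continuous_onI)

lemma prob_space: "prob_space \<nu>"
proof -
  have "integrable \<nu> (\<lambda>_. 1 :: real)"
    using integrable_eval[of 1] by (rule Bochner_Integration.integrable_cong[THEN iffD1, rotated -1])
      (auto simp: space_eq character_spaceD)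
  then have "emeasure \<nu> (space \<nu>) < \<infinity>"
    by (simp add: integrable_iff_bounded)
  then interpret finite_measure \<nu> by (intro finite_measureI) auto
  have "L 1 = (\<integral>\<alpha>. 1 \<partial>\<nu>)"
    unfolding L_eq_integral by (rule Bochner_Integration.integral_cong) (auto simp: space_eq character_spaceD)
  then show ?thesis
    using unit by (intro prob_spaceI) (simp add: emeasure_eq_measure)
qed

sublocale prob_space \<nu> by (rule prob_space)

lemma support_subset: "measure_support \<nu> \<subseteq> character_space"
  by (auto simp: measure_support_def space_eq)

text \<open>
  A compact set outside the support is covered by finitely many open null sets; inner regularity
  extends this from compact sets to the whole complement.
\<close>

lemma AE_support: "AE \<alpha> in \<nu>. \<alpha> \<in> measure_support \<nu>"
proof -
  let ?N = "character_space - measure_support \<nu>"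
  have N: "?N \<in> sets \<nu>"
    using compact_character_sets[OF sets_eq compact_support support_subset] sets.compl_sets
    by (metis space_eq)
  have "emeasure \<nu> K = 0" if K: "compact K" "K \<subseteq> ?N" for K
  proof -
    let ?C = "{U. open U \<and> emeasure \<nu> (U \<inter> character_space) = 0}"
    have cover: "K \<subseteq> \<Union> ?C"
    proof
      fix \<alpha>
      assume "\<alpha> \<in> K"
      then have "\<alpha> \<in> space \<nu>" "\<alpha> \<notin> measure_support \<nu>"
        using K(2) by (auto simp: space_eq)
      then show "\<alpha> \<in> \<Union> ?C"
        unfolding measure_support_def space_eq by (auto simp: not_less)
    qed
    obtain D where D: "D \<subseteq> ?C" "finite D" "K \<subseteq> \<Union> D"
      by (rule compactE[OF K(1) cover]) auto
    have "emeasure \<nu> K \<le> emeasure \<nu> (\<Union>U\<in>D. U \<inter> character_space)"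
      using D K by (intro emeasure_mono sets.finite_UN) (auto intro: open_Int_sets)
    also have "\<dots> \<le> (\<Sum>U\<in>D. emeasure \<nu> (U \<inter> character_space))"
      using D by (intro emeasure_subadditive_finite) (auto intro: open_Int_sets)
    also have "\<dots> = 0" using D by (intro sum.neutral) auto
    finally show ?thesis by simp
  qed
  then have "emeasure \<nu> ?N = 0"
    unfolding inner_regularity[OF N] by (simp add: SUP_eq_const bot_ennreal[symmetric] del: bot_ennreal)
  then show ?thesis
    using N by (intro AE_I[of _ _ ?N]) (auto simp: space_eq)
qed

lemma L_pos_if_nonneg_on_support:
  assumes "\<And>\<alpha>. \<alpha> \<in> measure_support \<nu> \<Longrightarrow> 0 \<le> \<alpha> b"
  shows "L_pos b"
  unfolding L_pos_def L_eq_integral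
proof
  fix x
  show "0 \<le> (\<integral>\<alpha>. \<alpha> (b * x\<^sup>2) \<partial>\<nu>)"
  proof (rule integral_nonneg_AE)
    show "AE \<alpha> in \<nu>. 0 \<le> \<alpha> (b * x\<^sup>2)"
      using AE_support AE_space
    proof eventually_elim
      case (elim \<alpha>)
      then show ?case using assms[of \<alpha>] by (simp add: space_eq character_spaceD(3,7))
    qed
  qed
qed

lemma evaluation_bounded_on_support:
  "\<exists>C. \<forall>\<alpha>\<in>measure_support \<nu>. \<bar>\<alpha> x\<bar> \<le> C"
proof -
  have "bounded ((\<lambda>\<alpha>. \<alpha> x) ` measure_support \<nu>)"
    by (intro compact_imp_bounded compact_continuous_image compact_support
        continuous_on_subset[OF continuous_on_product_coordinates subset_UNIV])
  then obtain C where "\<forall>y\<in>(\<lambda>\<alpha>. \<alpha> x) ` measure_support \<nu>. norm y \<le> C"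
    unfolding bounded_iff ..
  then show ?thesis by auto
qed

text \<open>
  If \<open>\<alpha>\<^sub>0 b < 0\<close> at a point of the support, then the negative part \<open>f\<close> of \<open>b\<close> does not vanish
  almost everywhere, so \<open>\<integral> b * f\<^sup>2 = - \<integral> f\<^sup>3 < 0\<close>; but \<open>f\<close> is a uniform limit of elements \<open>x\<close> of the
  algebra on the support, and \<open>\<integral> b * x\<^sup>2 = L (b * x\<^sup>2) \<ge> 0\<close>.
\<close>

lemma nonneg_on_support_if_L_pos:
  fixes t :: "nat \<Rightarrow> 'a"
  assumes generates: "generates_algebra (t ` I)" and b: "L_pos b"
    and \<alpha>\<^sub>0: "\<alpha>\<^sub>0 \<in> measure_support \<nu>"
  shows "0 \<le> \<alpha>\<^sub>0 b"
proof -
  let ?K = "measure_support \<nu>" and ?f = "\<lambda>\<alpha> :: 'a \<Rightarrow> real. max 0 (- \<alpha> b)"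
  obtain g where g: "polynomial_lift t I b g"
    using polynomial_lift_exists[OF generates] by blast
  have "continuous_on UNIV (\<lambda>u. max 0 (- g u))"
    by (intro continuous_on_max continuous_on_const continuous_on_minus continuous_on_polynomial_lift[OF g])
  then have "\<exists>x. \<forall>\<alpha>\<in>?K. \<bar>max 0 (- g (coordinates t I \<alpha>)) - \<alpha> x\<bar> < inverse (real (Suc n))" for n
    by (intro approximation_by_algebra_element[OF generates compact_support support_subset]) auto
  then obtain x where
    "\<And>n \<alpha>. \<alpha> \<in> ?K \<Longrightarrow> \<bar>max 0 (- g (coordinates t I \<alpha>)) - \<alpha> (x n)\<bar> < inverse (real (Suc n))"
    by metis
  then have x: "\<bar>?f \<alpha> - \<alpha> (x n)\<bar> < inverse (real (Suc n))" if "\<alpha> \<in> ?K" for n \<alpha>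
    using that support_subset by (auto simp: character_eq_polynomial_lift[OF g])
  obtain C where C: "\<And>\<alpha>. \<alpha> \<in> ?K \<Longrightarrow> \<bar>\<alpha> b\<bar> \<le> C"
    using evaluation_bounded_on_support by blast
  have coord: "continuous_on UNIV (\<lambda>\<alpha> :: 'a \<Rightarrow> real. \<alpha> y)" for y
    by (rule continuous_on_product_coordinates)
  have f_cont: "continuous_on UNIV ?f"
    by (intro continuous_on_max continuous_on_const continuous_on_minus coord)
  have "(\<lambda>n. \<integral>\<alpha>. \<alpha> b * (\<alpha> (x n))\<^sup>2 \<partial>\<nu>) \<longlonglongrightarrow> (\<integral>\<alpha>. \<alpha> b * (?f \<alpha>)\<^sup>2 \<partial>\<nu>)"
  proof (rule integral_dominated_convergence[where w = "\<lambda>_. C * (C + 1)\<^sup>2"])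
    show "(\<lambda>\<alpha>. \<alpha> b * (?f \<alpha>)\<^sup>2) \<in> borel_measurable \<nu>" "(\<lambda>\<alpha>. \<alpha> b * (\<alpha> (x n))\<^sup>2) \<in> borel_measurable \<nu>" for n
      by (intro continuous_measurable continuous_on_mult continuous_on_power coord f_cont)+
    show "AE \<alpha> in \<nu>. (\<lambda>n. \<alpha> b * (\<alpha> (x n))\<^sup>2) \<longlonglongrightarrow> \<alpha> b * (?f \<alpha>)\<^sup>2"
      using AE_support
    proof eventually_elim
      case (elim \<alpha>)
      have "(\<lambda>n. \<alpha> (x n) - ?f \<alpha>) \<longlonglongrightarrow> 0"
        by (rule Lim_null_comparison[OF _ LIMSEQ_inverse_real_of_nat])
          (rule always_eventually, use x[OF elim] in \<open>simp add: abs_minus_commute less_imp_le\<close>)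
      then have "(\<lambda>n. \<alpha> (x n)) \<longlonglongrightarrow> ?f \<alpha>" by (rule LIM_zero_cancel)
      then show ?case by (intro tendsto_intros)
    qed
    show "AE \<alpha> in \<nu>. norm (\<alpha> b * (\<alpha> (x n))\<^sup>2) \<le> C * (C + 1)\<^sup>2" for n
      using AE_support
    proof eventually_elim
      case (elim \<alpha>)
      have "inverse (real (Suc n)) \<le> 1" by (simp add: field_simps)
      then have "\<bar>\<alpha> (x n)\<bar> \<le> C + 1"
        using x[OF elim, of n] C[OF elim] by (simp add: max_def split: if_splits)
      then have "(\<alpha> (x n))\<^sup>2 \<le> (C + 1)\<^sup>2"
        by (metis abs_ge_zero power2_abs power_mono)
      then show ?case
        using C[OF elim] by (auto simp: abs_mult intro!: mult_mono')
    qed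
  qed simp
  moreover have "0 \<le> (\<integral>\<alpha>. \<alpha> b * (\<alpha> (x n))\<^sup>2 \<partial>\<nu>)" for n
  proof -
    have "(\<integral>\<alpha>. \<alpha> b * (\<alpha> (x n))\<^sup>2 \<partial>\<nu>) = L (b * (x n)\<^sup>2)"
      unfolding L_eq_integral
      by (rule Bochner_Integration.integral_cong) (simp_all add: space_eq character_spaceD(3,7))
    then show ?thesis using L_posD[OF b] by simp
  qed
  ultimately have nonneg: "0 \<le> (\<integral>\<alpha>. \<alpha> b * (?f \<alpha>)\<^sup>2 \<partial>\<nu>)"
    by (intro LIMSEQ_le_const) auto
  \<comment> \<open>Where \<open>\<alpha> b\<close> is nonnegative both sides vanish; elsewhere \<open>\<alpha> b\<close> is \<open>- ?f \<alpha>\<close>.\<close>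
  have cube: "\<alpha> b * (?f \<alpha>)\<^sup>2 = - (?f \<alpha> ^ 3)" for \<alpha>
    by (simp add: max_def power2_eq_square power3_eq_cube)
  have "integrable \<nu> (\<lambda>\<alpha>. ?f \<alpha> ^ 3)"
  proof (rule integrable_const_bound[where B = "C ^ 3"])
    show "AE \<alpha> in \<nu>. norm (?f \<alpha> ^ 3) \<le> C ^ 3"
      using AE_support
    proof eventually_elim
      case (elim \<alpha>)
      have "\<bar>?f \<alpha>\<bar> \<le> C" using C[OF elim] by (auto simp: max_def abs_if split: if_splits)
      then show ?case by (simp add: norm_power power_mono)
    qed
    show "(\<lambda>\<alpha>. ?f \<alpha> ^ 3) \<in> borel_measurable \<nu>"
      by (intro continuous_measurable continuous_on_power f_cont)
  qed
  moreover from this have "integral\<^sup>L \<nu> (\<lambda>\<alpha>. ?f \<alpha> ^ 3) = 0"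
    using nonneg unfolding cube by (intro antisym integral_nonneg) auto
  ultimately have "AE \<alpha> in \<nu>. ?f \<alpha> ^ 3 = 0"
    using integral_nonneg_eq_0_iff_AE[of \<nu> "\<lambda>\<alpha>. ?f \<alpha> ^ 3"] by simp
  then have ae: "AE \<alpha> in \<nu>. \<not> \<alpha> b < 0"
    by (rule AE_mp) (auto simp: max_def split: if_splits)
  show ?thesis
  proof (rule ccontr)
    let ?U = "{\<alpha> :: 'a \<Rightarrow> real. \<alpha> b < 0}"
    assume "\<not> 0 \<le> \<alpha>\<^sub>0 b"
    moreover have U: "open ?U" by (intro open_Collect_less coord continuous_on_const)
    ultimately have "0 < emeasure \<nu> (?U \<inter> character_space)"
      using \<alpha>\<^sub>0 by (auto simp: measure_support_def space_eq)
    moreover have "emeasure \<nu> (?U \<inter> character_space) = 0"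
      using ae AE_iff_measurable[OF open_Int_sets[OF U], of "\<lambda>\<alpha>. \<not> \<alpha> b < 0"]
      by (simp add: space_eq Int_def conj_commute)
    ultimately show False by simp
  qed
qed

text \<open>
  On the support \<open>f\<close> is within \<open>e\<close> of an evaluation, whose integral is prescribed by \<open>L\<close>.
\<close>

lemma integral_approximation:
  assumes K: "measure_support \<nu> \<subseteq> K"
    and f: "f \<in> borel_measurable \<nu>" and close: "\<And>\<alpha>. \<alpha> \<in> K \<Longrightarrow> \<bar>f \<alpha> - \<alpha> x\<bar> \<le> e"
  shows "\<bar>(\<integral>\<alpha>. f \<alpha> \<partial>\<nu>) - L x\<bar> \<le> e"
proof -
  have ae: "AE \<alpha> in \<nu>. norm (f \<alpha> - \<alpha> x) \<le> e"
    using AE_support by (rule AE_mp) (use K close in auto)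
  have diff: "integrable \<nu> (\<lambda>\<alpha>. f \<alpha> - \<alpha> x)"
    using ae by (rule integrable_const_bound)
      (use f integrable_eval[of x] in \<open>auto intro: borel_measurable_diff\<close>)
  then have "integrable \<nu> (\<lambda>\<alpha>. (f \<alpha> - \<alpha> x) + \<alpha> x)"
    by (intro Bochner_Integration.integrable_add integrable_eval)
  then have "(\<integral>\<alpha>. f \<alpha> \<partial>\<nu>) - L x = (\<integral>\<alpha>. f \<alpha> - \<alpha> x \<partial>\<nu>)"
    unfolding L_eq_integral using integrable_eval[of x] by simp
  also have "\<bar>\<dots>\<bar> \<le> (\<integral>\<alpha>. e \<partial>\<nu>)"
    using ae diff by (intro order_trans[OF integral_abs_bound] integral_mono_AE) auto
  finally show ?thesis by (simp add: prob_space)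
qed

end

lemma compact_representation_integral_unique:
  fixes L :: "'a::{real_algebra_1,comm_ring_1} \<Rightarrow> real"
  and f :: "(nat \<Rightarrow> real) \<Rightarrow> real" and t :: "nat \<Rightarrow> 'a"
  assumes \<nu>\<^sub>1: "compact_representation L \<nu>\<^sub>1" and \<nu>\<^sub>2: "compact_representation L \<nu>\<^sub>2"
    and generates: "generates_algebra (t ` I)" and f: "continuous_on UNIV f"
  shows "(\<integral>\<alpha>. f (coordinates t I \<alpha>) \<partial>\<nu>\<^sub>1) = (\<integral>\<alpha>. f (coordinates t I \<alpha>) \<partial>\<nu>\<^sub>2)"
proof -
  interpret one: compact_representation L \<nu>\<^sub>1 by (rule \<nu>\<^sub>1)
  interpret two: compact_representation L \<nu>\<^sub>2 by (rule \<nu>\<^sub>2)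
  let ?K = "measure_support \<nu>\<^sub>1 \<union> measure_support \<nu>\<^sub>2" and ?f = "\<lambda>\<alpha>. f (coordinates t I \<alpha>)"
  have K: "compact ?K" "?K \<subseteq> character_space"
    using one.compact_support two.compact_support one.support_subset two.support_subset
    by (auto intro: compact_Un)
  have cont: "continuous_on UNIV ?f"
    by (rule continuous_on_compose2[OF f continuous_on_coordinates]) simp
  have "\<bar>integral\<^sup>L \<nu>\<^sub>1 ?f - integral\<^sup>L \<nu>\<^sub>2 ?f\<bar> \<le> e" if "0 < e" for e
  proof -
    obtain x where "\<forall>\<alpha>\<in>?K. \<bar>?f \<alpha> - \<alpha> x\<bar> < e / 2"
      using approximation_by_algebra_element[OF generates K f half_gt_zero[OF \<open>0 < e\<close>]] ..
    then have "\<bar>integral\<^sup>L \<nu>\<^sub>1 ?f - L x\<bar> \<le> e / 2" "\<bar>integral\<^sup>L \<nu>\<^sub>2 ?f - L x\<bar> \<le> e / 2"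
      by (intro one.integral_approximation[of ?K] two.integral_approximation[of ?K]
          one.continuous_measurable two.continuous_measurable cont; force intro: less_imp_le)+
    then show ?thesis by linarith
  qed
  then show ?thesis
    using field_le_epsilon[of "\<bar>integral\<^sup>L \<nu>\<^sub>1 ?f - integral\<^sup>L \<nu>\<^sub>2 ?f\<bar>" 0] by auto
qed

text \<open>
  The indicator function of a compact set is a limit of continuous functions of the coordinates:
  tents of slope \<open>n\<close> over its image, which is closed and determines the set by injectivity.
\<close>

lemma (in compact_representation) measure_compact_eq_limit:
  fixes t :: "nat \<Rightarrow> 'a"
  assumes generates: "generates_algebra (t ` I)"
    and C: "compact C" "C \<subseteq> character_space" "C \<noteq> {}"
  shows "(\<lambda>n. \<integral>\<alpha>. max 0 (1 - real n * infdist (coordinates t I \<alpha>) (coordinates t I ` C)) \<partial>\<nu>)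
    \<longlonglongrightarrow> measure \<nu> C"
proof -
  let ?\<phi> = "coordinates t I"
  let ?f = "\<lambda>n \<alpha>. max 0 (1 - real n * infdist (?\<phi> \<alpha>) (?\<phi> ` C))"
  have "closed (?\<phi> ` C)"
    by (intro compact_imp_closed compact_continuous_image continuous_on_coordinates C)
  have C_sets: "C \<in> sets \<nu>"
    by (rule compact_character_sets[OF sets_eq C(1,2)])
  have "(\<lambda>n. integral\<^sup>L \<nu> (?f n)) \<longlonglongrightarrow> (\<integral>\<alpha>. indicator C \<alpha> \<partial>\<nu>)"
  proof (rule integral_dominated_convergence[where w = "\<lambda>_. 1"])
    show "?f n \<in> borel_measurable \<nu>" for n
      by (intro continuous_measurable continuous_on_max continuous_on_const continuous_on_diff
          continuous_on_mult continuous_on_infdist continuous_on_coordinates)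
    show "AE \<alpha> in \<nu>. (\<lambda>n. ?f n \<alpha>) \<longlonglongrightarrow> indicator C \<alpha>"
    proof (rule AE_I2)
      fix \<alpha>
      assume "\<alpha> \<in> space \<nu>"
      then have \<alpha>: "\<alpha> \<in> character_space" by (simp add: space_eq)
      show "(\<lambda>n. ?f n \<alpha>) \<longlonglongrightarrow> indicator C \<alpha>"
      proof (cases "\<alpha> \<in> C")
        case False
        then have "?\<phi> \<alpha> \<notin> ?\<phi> ` C"
          using inj_on_coordinates[OF generates] \<alpha> C(2) by (auto dest: inj_onD)
        then have pos: "0 < infdist (?\<phi> \<alpha>) (?\<phi> ` C)"
          using infdist_pos_not_in_closed[OF \<open>closed (?\<phi> ` C)\<close>] C(3) by auto
        obtain N where N: "1 \<le> real N * infdist (?\<phi> \<alpha>) (?\<phi> ` C)"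
          using reals_Archimedean3[OF pos, rule_format, of 1] less_imp_le by blast
        have "?f n \<alpha> = 0" if "N \<le> n" for n
        proof -
          have "real N * infdist (?\<phi> \<alpha>) (?\<phi> ` C) \<le> real n * infdist (?\<phi> \<alpha>) (?\<phi> ` C)"
            using that pos by (intro mult_right_mono) auto
          then show ?thesis using N by simp
        qed
        then have "\<forall>\<^sub>F n in sequentially. ?f n \<alpha> = 0"
          by (rule eventually_sequentiallyI)
        then show ?thesis using False by (simp add: tendsto_eventually)
      qed simp
    qed
    show "AE \<alpha> in \<nu>. norm (?f n \<alpha>) \<le> 1" for n
      by (simp add: infdist_nonneg)
  qed (use C_sets in simp_all)
  then show ?thesis using C_sets by simp
qed

text \<open>
  Equality of the integrals of the tents gives equality on compact sets, which determine a Radon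
  measure.
\<close>

theorem compact_representation_unique:
  fixes L :: "'a::{real_algebra_1,comm_ring_1} \<Rightarrow> real"
  and t :: "nat \<Rightarrow> 'a"
  assumes \<nu>\<^sub>1: "compact_representation L \<nu>\<^sub>1" and \<nu>\<^sub>2: "compact_representation L \<nu>\<^sub>2"
    and generates: "generates_algebra (t ` I)"
  shows "\<nu>\<^sub>1 = \<nu>\<^sub>2"
proof -
  interpret one: compact_representation L \<nu>\<^sub>1 by (rule \<nu>\<^sub>1)
  interpret two: compact_representation L \<nu>\<^sub>2 by (rule \<nu>\<^sub>2)
  have on_compact: "emeasure \<nu>\<^sub>1 C = emeasure \<nu>\<^sub>2 C" if C: "compact C" "C \<subseteq> character_space" for C
  proof (cases "C = {}")
    case False
    let ?f = "\<lambda>n u. max 0 (1 - real n * infdist u (coordinates t I ` C))"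
    have "continuous_on UNIV (?f n)" for n
      by (intro continuous_on_max continuous_on_const continuous_on_diff continuous_on_mult
          continuous_on_infdist continuous_on_id)
    then have eq: "(\<integral>\<alpha>. ?f n (coordinates t I \<alpha>) \<partial>\<nu>\<^sub>1) = (\<integral>\<alpha>. ?f n (coordinates t I \<alpha>) \<partial>\<nu>\<^sub>2)" for n
      by (rule compact_representation_integral_unique[OF \<nu>\<^sub>1 \<nu>\<^sub>2 generates])
    have "measure \<nu>\<^sub>1 C = measure \<nu>\<^sub>2 C"
      using one.measure_compact_eq_limit[OF generates C False, unfolded eq]
        two.measure_compact_eq_limit[OF generates C False] by (rule LIMSEQ_unique)
    then show ?thesis by (simp add: one.emeasure_eq_measure two.emeasure_eq_measure)
  qed simp
  show ?thesis
  proof (rule measure_eqI)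
    show sets: "sets \<nu>\<^sub>1 = sets \<nu>\<^sub>2" by (simp add: one.sets_eq two.sets_eq)
    fix B
    assume B: "B \<in> sets \<nu>\<^sub>1"
    then have "B \<subseteq> character_space"
      using sets.sets_into_space by (fastforce simp: one.space_eq)
    then show "emeasure \<nu>\<^sub>1 B = emeasure \<nu>\<^sub>2 B"
      unfolding one.inner_regularity[OF B] two.inner_regularity[OF B[unfolded sets]]
      by (intro SUP_cong refl on_compact) auto
  qed
qed

section \<open>The extremal ratios\<close>

context psd_state
begin

text \<open>
  By the Cauchy--Schwarz inequality; so the elements \<open>x\<close> with \<open>L (x\<^sup>2) = 0\<close>, which the ratios
  leave out, satisfy every inequality \<open>L (b * x\<^sup>2) \<ge> 0\<close> trivially.
\<close>

lemma L_mult_square_eq_zero: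
  assumes "L (x\<^sup>2) = 0"
  shows "L (a * x\<^sup>2) = 0"
proof -
  have "(L (a * x * x))\<^sup>2 \<le> 0"
    using L_cauchy_schwarz[of "a * x" x] assms by simp
  then show ?thesis by (simp add: power2_eq_square[of x] mult.assoc)
qed

lemma le_inf_ratio_iff: "ereal c \<le> inf_ratio L a \<longleftrightarrow> L_pos (a - of_real c)"
proof -
  have "c \<le> L (a * x\<^sup>2) / L (x\<^sup>2) \<longleftrightarrow> 0 \<le> L ((a - of_real c) * x\<^sup>2)" if "L (x\<^sup>2) \<noteq> 0" for x
    using that L_square_nonneg[of x] by (simp add: left_diff_distrib L_diff L_scale pos_le_divide_eq)
  moreover have "0 \<le> L ((a - of_real c) * x\<^sup>2)" if "L (x\<^sup>2) = 0" for x
    using L_mult_square_eq_zero[OF that] by simp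
  ultimately show ?thesis
    by (auto simp: inf_ratio_def L_pos_def le_INF_iff)
qed

lemma sup_ratio_le_iff: "sup_ratio L a \<le> ereal c \<longleftrightarrow> L_pos (of_real c - a)"
proof -
  have "L (a * x\<^sup>2) / L (x\<^sup>2) \<le> c \<longleftrightarrow> 0 \<le> L ((of_real c - a) * x\<^sup>2)" if "L (x\<^sup>2) \<noteq> 0" for x
    using that L_square_nonneg[of x] by (simp add: left_diff_distrib L_diff L_scale pos_divide_le_eq)
  moreover have "0 \<le> L ((of_real c - a) * x\<^sup>2)" if "L (x\<^sup>2) = 0" for x
    using L_mult_square_eq_zero[OF that] by simp
  ultimately show ?thesis
    by (auto simp: sup_ratio_def L_pos_def SUP_le_iff)
qed

end

lemma generates_algebra_affine:
  fixes a t :: "nat \<Rightarrow> 'a::real_algebra_1"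
  assumes generates: "generates_algebra (a ` I)"
    and affine: "\<And>i. i \<in> I \<Longrightarrow> \<exists>r s. a i = r *\<^sub>R t i + s *\<^sub>R 1"
  shows "generates_algebra (t ` I)"
proof -
  let ?B = "unital_subalgebra hull (t ` I)"
  have "unital_subalgebra (\<Inter>T)" if "\<forall>B\<in>T. unital_subalgebra B" for T :: "'a set set"
    using that unfolding unital_subalgebra_def by (auto intro: subspace_Inter)
  then have B: "unital_subalgebra ?B" by (rule hull_in) auto
  have "a ` I \<subseteq> ?B"
  proof (rule image_subsetI)
    fix i
    assume "i \<in> I"
    then have "t i \<in> ?B" by (intro hull_inc) auto
    then show "a i \<in> ?B"
      using affine[OF \<open>i \<in> I\<close>] B by (auto simp: unital_subalgebra_def intro!: subspace_add subspace_scale)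
  qed
  then have "unital_subalgebra hull (a ` I) \<subseteq> ?B" using B by (rule hull_minimal)
  then show ?thesis using generates by (auto simp: generates_algebra_def)
qed

text \<open>
  The upper bound of \<open>a i\<close> is \<open>C i\<close>, obtained from \<open>D\<close> by replacing the other generators by their
  lower bounds; \<open>t i\<close> rescales the interval \<open>[c i, C i]\<close> into \<open>[0, 1]\<close>. The length \<open>e i\<close> is enlarged to
  be positive in all cases, so that it can be inverted.
\<close>

lemma (in psd_state) bounded_generators:
  assumes I: "finite I" and generates: "generates_algebra (a ` I)"
    and lower: "\<And>i. i \<in> I \<Longrightarrow> L_pos (a i - of_real (c i))"
    and upper: "L_pos (of_real D - (\<Sum>i\<in>I. a i))"
  shows "\<exists>t. bounded_psd_state L t I"
proof -
  define C where "C i = D - (\<Sum>j\<in>I - {i}. c j)" for i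
  define e where "e i = \<bar>C i - c i\<bar> + 1" for i
  define t where "t i = of_real (inverse (e i)) * (a i - of_real (c i))" for i
  have e: "0 < e i" for i by (simp add: e_def add_nonneg_pos)
  have e_inv: "of_real (e i) * of_real (inverse (e i)) = (1::'a)" for i
    using e[of i] by (simp flip: of_real_mult)
  have "bounded_psd_state L t I"
  proof
    show "generates_algebra (t ` I)"
    proof (rule generates_algebra_affine[OF generates])
      fix i
      have "of_real (e i) * t i = a i - of_real (c i)"
        unfolding t_def by (simp only: e_inv mult_1_left flip: mult.assoc)
      then have "a i = e i *\<^sub>R t i + c i *\<^sub>R 1"
        by (simp add: scaleR_conv_of_real)
      then show "\<exists>r s. a i = r *\<^sub>R t i + s *\<^sub>R 1" by blast
    qed
    fix i
    assume i: "i \<in> I"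
    show "L_pos (t i)"
      unfolding t_def using lower[OF i] e[of i] by (intro L_pos_scale) auto
    have "L_pos ((of_real D - (\<Sum>j\<in>I. a j)) + (\<Sum>j\<in>I - {i}. a j - of_real (c j)) + of_real (e i - (C i - c i)))"
      using lower by (intro L_pos_add L_pos_sum L_pos_of_real upper) (auto simp: e_def)
    also have "(of_real D - (\<Sum>j\<in>I. a j)) + (\<Sum>j\<in>I - {i}. a j - of_real (c j)) + of_real (e i - (C i - c i))
        = of_real (e i) - (a i - of_real (c i))"
      using i I by (simp add: C_def sum_subtractf sum.remove[of I i a] of_real_sum)
    finally have "L_pos (of_real (inverse (e i)) * (of_real (e i) - (a i - of_real (c i))))"
      using e[of i] by (intro L_pos_scale) auto
    moreover have "of_real (inverse (e i)) * (of_real (e i) - (a i - of_real (c i))) = 1 - t i"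
      unfolding t_def using e_inv[of i] by (simp only: right_diff_distrib mult.commute)
    ultimately show "L_pos (1 - t i)" by simp
  qed (rule I)
  then show ?thesis by blast
qed

lemma ereal_le_of_real_bounds:
  assumes "\<And>c. ereal c \<le> x \<Longrightarrow> c \<le> y"
  shows "x \<le> ereal y"
proof (cases x)
  case PInf
  then show ?thesis using assms[of "y + 1"] by simp
qed (use assms in auto)

theorem proposition4p5:
  fixes a :: "nat \<Rightarrow> 'a::{real_algebra_1,comm_ring_1}"
    and m :: nat
    and L :: "'a \<Rightarrow> real"
  assumes "(character_space :: ('a \<Rightarrow> real) set) \<noteq> {}"
    and "generates_algebra (a ` {1..m})"
    and "psd_functional L"
    and "L 1 = 1"
  shows "((\<exists>!\<nu>. representing_measure L \<nu> \<and> compact (measure_support \<nu>)) \<longleftrightarrow>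
            (\<forall>i\<in>{1..m}. inf_ratio L (a i) > -\<infinity>) \<and> sup_ratio L (\<Sum>i=1..m. a i) < \<infinity>) \<and>
         (\<forall>\<nu>. representing_measure L \<nu> \<and> compact (measure_support \<nu>) \<longrightarrow>
            measure_support \<nu> \<subseteq>
              {\<alpha> \<in> character_space. (\<forall>i\<in>{1..m}. ereal (\<alpha> (a i)) \<ge> inf_ratio L (a i)) \<and>
                 ereal (\<Sum>i=1..m. \<alpha> (a i)) \<le> sup_ratio L (\<Sum>i=1..m. a i)})"
proof -
  interpret psd_state L by unfold_locales (fact assms)+
  note generates = assms(2)
  let ?bounded = "(\<forall>i\<in>{1..m}. inf_ratio L (a i) > -\<infinity>) \<and> sup_ratio L (\<Sum>i=1..m. a i) < \<infinity>"
  have representation: "compact_representation L \<nu>"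
    if "representing_measure L \<nu> \<and> compact (measure_support \<nu>)" for \<nu>
    using that by unfold_locales auto
  have bounded: ?bounded if "representing_measure L \<nu> \<and> compact (measure_support \<nu>)" for \<nu>
  proof -
    interpret compact_representation L \<nu> by (rule representation[OF that])
    have "L_pos (x - of_real (- C)) \<and> L_pos (of_real C - x)"
      if "\<forall>\<alpha>\<in>measure_support \<nu>. \<bar>\<alpha> x\<bar> \<le> C" for C x
    proof (intro conjI L_pos_if_nonneg_on_support)
      fix \<alpha>
      assume \<alpha>: "\<alpha> \<in> measure_support \<nu>"
      then have X: "\<alpha> \<in> character_space" using support_subset by blast
      show "0 \<le> \<alpha> (x - of_real (- C))" "0 \<le> \<alpha> (of_real C - x)"
        unfolding character_spaceD(5,6)[OF X] using that \<alpha> by force+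
    qed
    then have "\<exists>C. ereal (- C) \<le> inf_ratio L x \<and> sup_ratio L x \<le> ereal C" for x
      using evaluation_bounded_on_support[of x] unfolding le_inf_ratio_iff sup_ratio_le_iff by metis
    then show ?thesis
      by (metis MInfty_neq_ereal(1) PInfty_neq_ereal(1) ereal_infty_less(1,2) ereal_infty_less_eq(1,2))
  qed
  have unique: "\<nu>\<^sub>1 = \<nu>\<^sub>2"
    if "representing_measure L \<nu>\<^sub>1 \<and> compact (measure_support \<nu>\<^sub>1)"
      "representing_measure L \<nu>\<^sub>2 \<and> compact (measure_support \<nu>\<^sub>2)" for \<nu>\<^sub>1 \<nu>\<^sub>2
    by (rule compact_representation_unique[OF representation[OF that(1)] representation[OF that(2)] generates])
  have exists: "\<exists>\<nu>. representing_measure L \<nu> \<and> compact (measure_support \<nu>)" if bd: ?bounded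
  proof -
    have "\<exists>c. i \<in> {1..m} \<longrightarrow> ereal c \<le> inf_ratio L (a i)" for i
      using bd by (cases "inf_ratio L (a i)") (auto intro: exI[of _ 0])
    then obtain c where c: "\<And>i. i \<in> {1..m} \<Longrightarrow> ereal (c i) \<le> inf_ratio L (a i)"
      by metis
    obtain D where D: "sup_ratio L (\<Sum>i=1..m. a i) \<le> ereal D"
      using conjunct2[OF bd] by (cases "sup_ratio L (\<Sum>i=1..m. a i)") auto
    obtain t where "bounded_psd_state L t {1..m}"
      using bounded_generators[OF _ generates c[unfolded le_inf_ratio_iff] D[unfolded sup_ratio_le_iff]]
      by blast
    then show ?thesis
      using bounded_psd_state.representing_measure_exists assms(1) by blast
  qed
  have support: "measure_support \<nu> \<subseteq>
      {\<alpha> \<in> character_space. (\<forall>i\<in>{1..m}. ereal (\<alpha> (a i)) \<ge> inf_ratio L (a i)) \<and>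
         ereal (\<Sum>i=1..m. \<alpha> (a i)) \<le> sup_ratio L (\<Sum>i=1..m. a i)}"
    if "representing_measure L \<nu> \<and> compact (measure_support \<nu>)" for \<nu>
  proof
    fix \<alpha>
    assume \<alpha>: "\<alpha> \<in> measure_support \<nu>"
    interpret compact_representation L \<nu> by (rule representation[OF that])
    have X: "\<alpha> \<in> character_space" using \<alpha> support_subset by blast
    note nonneg = nonneg_on_support_if_L_pos[OF generates _ \<alpha>]
    have "inf_ratio L x \<le> ereal (\<alpha> x)" for x
    proof (rule ereal_le_of_real_bounds)
      show "c \<le> \<alpha> x" if "ereal c \<le> inf_ratio L x" for c
        using nonneg[of "x - of_real c"] that by (simp add: le_inf_ratio_iff character_spaceD[OF X])
    qed
    moreover have "ereal (\<alpha> x) \<le> sup_ratio L x" for x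
    proof (rule ereal_le_real)
      show "ereal (\<alpha> x) \<le> ereal c" if "sup_ratio L x \<le> ereal c" for c
        using nonneg[of "of_real c - x"] that by (simp add: sup_ratio_le_iff character_spaceD[OF X])
    qed
    moreover have "(\<Sum>i=1..m. \<alpha> (a i)) = \<alpha> (\<Sum>i=1..m. a i)"
      by (rule linear_sum[OF character_spaceD(1)[OF X], symmetric])
    ultimately show "\<alpha> \<in> {\<alpha> \<in> character_space. (\<forall>i\<in>{1..m}. ereal (\<alpha> (a i)) \<ge> inf_ratio L (a i)) \<and>
         ereal (\<Sum>i=1..m. \<alpha> (a i)) \<le> sup_ratio L (\<Sum>i=1..m. a i)}"
      using X by simp
  qed
  from exists bounded unique support show ?thesis by (blast intro: ex1I)
qed

end
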